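(* Let $N \ge 2$ be an integer, let $U(x) = \log \frac{C_N}{\left(1+|x|^{\frac{N}{N-1}}\right)^N}$ for $x \in \mathbb{R}^N$, where $C_N = N\left(\frac{N^2}{N-1}\right)^{N-1}$, and let $L$ be the linearized operator $$L(\phi) = \operatorname{div}\left(|\nabla U|^{N-2}\nabla\phi\right) + (N-2)\operatorname{div}\left(|\nabla U|^{N-4}(\nabla U\cdot\nabla\phi)\nabla U\right) + e^U\phi .$$ Let $\phi \in L^\infty(\mathbb{R}^N)\cap C^2(\mathbb{R}^N)$ be a solution of $L(\phi)=0$. Then $\phi$ can be written as a linear combination of the functions $Z_0, Z_1,\dots,Z_N$ given by $$Z_0(x) = x\cdot\nabla U(x) + N, \qquad Z_i(x) = \frac{\partial U}{\partial x_i}(x) \quad (i=1,\dots,N).$$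
   Context: Here $\cdot$ denotes the standard inner product on $\mathbb{R}^N$ and $|\cdot|$ the Euclidean norm. The function $U$ is an explicit solution of the $N$-Laplace Liouville equation $-\Delta_N U = e^U$ in $\mathbb{R}^N$ with $\int_{\mathbb{R}^N} e^U\,dx<\infty$, where $\Delta_N U = \operatorname{div}(|\nabla U|^{N-2}\nabla U)$, and $L(\phi) = \frac{d}{dt}\big|_{t=0}\left[\Delta_N(U+t\phi)+e^{U+t\phi}\right]$. All functions are real-valued, and linear combinations have real coefficients. Since $\nabla U$ vanishes at $x=0$ (and only there), the expression $L(\phi)$ is read pointwise at $x \neq 0$. *)

theory Defs
  imports "HOL-Analysis.Analysis"
begin

definition partial_deriv :: "'n::finite \<Rightarrow> (real^'n \<Rightarrow> real) \<Rightarrow> real^'n \<Rightarrow> real" where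
  "partial_deriv i f x = deriv (\<lambda>t. f (x + t *\<^sub>R axis i 1)) 0"

definition grad :: "(real^'n::finite \<Rightarrow> real) \<Rightarrow> real^'n \<Rightarrow> real^'n" where
  "grad f x = (\<chi> i. partial_deriv i f x)"

definition divergence :: "(real^'n::finite \<Rightarrow> real^'n) \<Rightarrow> real^'n \<Rightarrow> real" where
  "divergence F x = (\<Sum>i\<in>UNIV. partial_deriv i (\<lambda>y. F y $ i) x)"

definition C1 :: "(real^'n::finite \<Rightarrow> real) \<Rightarrow> bool" where
  "C1 f \<longleftrightarrow> (\<forall>x. f differentiable (at x)) \<and> (\<forall>i. continuous_on UNIV (partial_deriv i f))"

definition C2 :: "(real^'n::finite \<Rightarrow> real) \<Rightarrow> bool" where
  "C2 f \<longleftrightarrow> C1 f \<and> (\<forall>i. C1 (partial_deriv i f))"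

definition L_infinity :: "(real^'n::finite \<Rightarrow> real) \<Rightarrow> bool" where
  "L_infinity f \<longleftrightarrow>
     f \<in> borel_measurable lebesgue \<and> (\<exists>M. AE x in lebesgue. \<bar>f x\<bar> \<le> M)"

definition liouville_const :: "nat \<Rightarrow> real" where
  "liouville_const N = real N * ((real N)\<^sup>2 / (real N - 1)) ^ (N - 1)"

definition liouville_U :: "real^'n::finite \<Rightarrow> real" where
  "liouville_U x =
     ln (liouville_const CARD('n) /
         (1 + norm x powr (real CARD('n) / (real CARD('n) - 1))) ^ CARD('n))"

text \<open>
  The exponents are integers, and \<open>N - 4\<close> may be negative, hence \<open>powi\<close>.
  As the gradient of \<open>liouville_U\<close> vanishes at the origin, the value of
  \<open>linearized_op \<phi> x\<close> is meaningful only for \<open>x \<noteq> 0\<close>.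
\<close>

definition linearized_op :: "(real^'n::finite \<Rightarrow> real) \<Rightarrow> real^'n \<Rightarrow> real" where
  "linearized_op \<phi> x =
     divergence (\<lambda>y. (norm (grad liouville_U y) powi (int CARD('n) - 2)) *\<^sub>R grad \<phi> y) x
     + (real CARD('n) - 2) *
       divergence (\<lambda>y. (norm (grad liouville_U y) powi (int CARD('n) - 4) *
                        (grad liouville_U y \<bullet> grad \<phi> y)) *\<^sub>R grad liouville_U y) x
     + exp (liouville_U x) * \<phi> x"

definition Z0 :: "real^'n::finite \<Rightarrow> real" where
  "Z0 x = x \<bullet> grad liouville_U x + real CARD('n)"

definition Z :: "'n::finite \<Rightarrow> real^'n \<Rightarrow> real" where
  "Z i x = partial_deriv i liouville_U x"

end

theory Submission
  imports Defs
begin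

text \<open>
  Write \<open>N\<close> for the dimension, \<open>q = N / (N - 1)\<close>, \<open>r = norm x\<close>, \<open>s = ln r\<close> and
  \<open>y = r powr q / (1 + r powr q)\<close>; as a function of \<open>s\<close>, \<open>y\<close> is logistic,
  \<open>y' = q y (1 - y)\<close>. Off the origin the gradient of \<open>liouville_U\<close> is \<open>- N q y x / r\<^sup>2\<close>, and
  the linearized operator, multiplied by a positive function, becomes
  \<open>r\<^sup>2 \<Delta>\<phi> + (N - 2) D\<^sup>2\<phi>(x, x) + N (N - 2) (1 - y) x \<bullet> \<nabla>\<phi> + N\<^sup>2 q y (1 - y) \<phi>\<close> (lemma
  \<open>linearized_op_eq\<close>). Up to constant factors the claimed solutions are the dipoles
  \<open>y (x \<bullet> e) / r\<^sup>2\<close> and the radial function \<open>1 - q y\<close>.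

  No expansion in spherical harmonics is used; reflections take its place. Let \<open>e\<close> be a unit
  vector and let \<open>u\<close> be \<open>\<phi>\<close> minus its reflection in the hyperplane orthogonal to \<open>e\<close>. Then
  \<open>u\<close> is a bounded solution that vanishes on this hyperplane, and the dipole in the
  direction \<open>e\<close> is a solution that is positive on the half space \<open>x \<bullet> e > 0\<close>. Because \<open>\<phi>\<close>
  has a continuous gradient at the origin, the quotient of \<open>u\<close> and the dipole has a limit
  there, namely \<open>2 L (\<nabla>\<phi>(0) \<bullet> e)\<close> with \<open>L = lim r\<^sup>2 / y\<close>, which is 1 for \<open>N = 2\<close> and 0 for
  \<open>N \<ge> 3\<close>. A maximum principle of Phragmen-Lindelof type on the half space
  (\<open>halfspace_comparison\<close>) turns the limit into the identity \<open>u = 2 L (\<nabla>\<phi>(0) \<bullet> e)\<close> times the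
  dipole (\<open>reflection_difference\<close>). It rests on a positive strict supersolution that tends
  to infinity (\<open>halfspace_barrier\<close>).

  The dependence on \<open>e\<close> is linear, so subtracting \<open>L\<close> times the dipole in the direction
  \<open>\<nabla>\<phi>(0)\<close> from \<open>\<phi>\<close> leaves a function that is invariant under all reflections, that is, a
  radial one. Its profile solves a second-order linear equation; \<open>y ^ (N - 2)\<close> times its
  Wronskian with \<open>1 - q y\<close> is constant and tends to 0 at the origin, so the profile is a
  multiple of \<open>1 - q y\<close> (\<open>radial_solution_eq\<close>).
\<close>

section \<open>Second-order jets\<close>

text \<open>
  The gradient \<open>g\<close> and the Hessian \<open>H\<close>, as a linear map at each point, are carried along
  with the function: the rules below then compute the second-order operator on sums,
  products, radial functions and reflections without touching partial derivatives. The set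
  is open because the derivative of \<open>g\<close> at a point refers to the gradient at all nearby
  points.
\<close>

definition has_jet :: "(real^'n::finite \<Rightarrow> real) \<Rightarrow> (real^'n \<Rightarrow> real^'n) \<Rightarrow>
     (real^'n \<Rightarrow> real^'n \<Rightarrow> real^'n) \<Rightarrow> (real^'n) set \<Rightarrow> bool"
  where "has_jet f g H S \<longleftrightarrow> open S \<and>
    (\<forall>x\<in>S. (f has_derivative (\<lambda>v. g x \<bullet> v)) (at x) \<and> (g has_derivative H x) (at x))"

definition lin_trace :: "(real^'n::finite \<Rightarrow> real^'n) \<Rightarrow> real" where
  "lin_trace T = (\<Sum>i\<in>UNIV. T (axis i 1) $ i)"

lemma has_jetD:
  assumes "has_jet f g H S" "x \<in> S"
  shows "(f has_derivative (\<lambda>v. g x \<bullet> v)) (at x)" "(g has_derivative H x) (at x)"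
    "bounded_linear (H x)"
  using assms unfolding has_jet_def by (auto intro: has_derivative_bounded_linear)

lemma has_jet_open: "has_jet f g H S \<Longrightarrow> open S"
  by (simp add: has_jet_def)

lemma has_jet_subset: "has_jet f g H S \<Longrightarrow> open T \<Longrightarrow> T \<subseteq> S \<Longrightarrow> has_jet f g H T"
  by (auto simp: has_jet_def)

lemma has_jet_const: "open S \<Longrightarrow> has_jet (\<lambda>x. c) (\<lambda>x. 0) (\<lambda>x v. 0) S"
  by (auto simp: has_jet_def)

lemma has_jet_inner: "open S \<Longrightarrow> has_jet (\<lambda>x. x \<bullet> e) (\<lambda>x. e) (\<lambda>x v. 0) S"
  by (auto simp: has_jet_def inner_commute intro!: derivative_eq_intros)

lemma has_jetI:
  assumes "open S" "\<And>x. x \<in> S \<Longrightarrow> (f has_derivative D x) (at x)"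
    "\<And>x v. x \<in> S \<Longrightarrow> D x v = g x \<bullet> v"
    "\<And>x. x \<in> S \<Longrightarrow> (g has_derivative H x) (at x)"
  shows "has_jet f g H S"
  unfolding has_jet_def
proof (intro conjI ballI)
  fix x assume x: "x \<in> S"
  show "(f has_derivative (\<lambda>v. g x \<bullet> v)) (at x)"
    by (rule has_derivative_eq_rhs[OF assms(2)[OF x]]) (simp add: fun_eq_iff assms(3)[OF x])
qed (use assms in auto)

lemma has_jet_add:
  assumes "has_jet f g H S" "has_jet f' g' H' S"
  shows "has_jet (\<lambda>x. f x + f' x) (\<lambda>x. g x + g' x) (\<lambda>x v. H x v + H' x v) S"
  using assms
  by (intro has_jetI[where D = "\<lambda>x v. g x \<bullet> v + g' x \<bullet> v"])
     (auto simp: inner_add_left dest: has_jetD has_jet_open intro!: has_derivative_add)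

lemma has_jet_scale:
  assumes "has_jet f g H S"
  shows "has_jet (\<lambda>x. c * f x) (\<lambda>x. c *\<^sub>R g x) (\<lambda>x v. c *\<^sub>R H x v) S"
  using assms
  by (intro has_jetI[where D = "\<lambda>x v. c * (g x \<bullet> v)"])
     (auto dest: has_jetD has_jet_open intro!: has_derivative_mult_right has_derivative_scaleR_right)

lemma has_jet_mult:
  assumes "has_jet f g H S" "has_jet f' g' H' S"
  shows "has_jet (\<lambda>x. f x * f' x) (\<lambda>x. f x *\<^sub>R g' x + f' x *\<^sub>R g x)
    (\<lambda>x v. f x *\<^sub>R H' x v + (g x \<bullet> v) *\<^sub>R g' x + f' x *\<^sub>R H x v + (g' x \<bullet> v) *\<^sub>R g x) S"
  unfolding has_jet_def
proof (intro conjI ballI)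
  show "open S" using assms(1) by (rule has_jet_open)
next
  fix x assume x: "x \<in> S"
  note d = has_jetD[OF assms(1) x] has_jetD[OF assms(2) x]
  show "((\<lambda>x. f x * f' x) has_derivative (\<lambda>v. (f x *\<^sub>R g' x + f' x *\<^sub>R g x) \<bullet> v)) (at x)"
    using has_derivative_mult[OF d(1) d(4)] 
    by (rule has_derivative_eq_rhs) (auto simp: inner_add_left mult.commute)
  show "((\<lambda>x. f x *\<^sub>R g' x + f' x *\<^sub>R g x) has_derivative
    (\<lambda>v. f x *\<^sub>R H' x v + (g x \<bullet> v) *\<^sub>R g' x + f' x *\<^sub>R H x v + (g' x \<bullet> v) *\<^sub>R g x)) (at x)"
    using has_derivative_add[OF has_derivative_scaleR[OF d(1) d(5)] has_derivative_scaleR[OF d(4) d(2)]]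
    by (rule has_derivative_eq_rhs) (auto simp: fun_eq_iff)
qed

lemma inner_ext_left: "(\<And>v::'a::real_inner. a \<bullet> v = b \<bullet> v) \<Longrightarrow> a = b"
  by (metis inner_diff_left inner_eq_zero_iff right_minus_eq)

text \<open>
  The Hessian is determined because the two gradients agree on a whole neighbourhood.
\<close>

lemma has_jet_unique:
  assumes "has_jet f g H S" "has_jet f g' H' S" "x \<in> S"
  shows "g x = g' x" "H x = H' x"
proof -
  have eq: "g y = g' y" if y: "y \<in> S" for y
  proof (rule inner_ext_left)
    fix v
    show "g y \<bullet> v = g' y \<bullet> v"
      using has_derivative_unique[OF has_jetD(1)[OF assms(1) y] has_jetD(1)[OF assms(2) y]]
      by (rule fun_cong)
  qed
  show "g x = g' x" by (rule eq[OF assms(3)])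
  have "(g has_derivative H' x) (at x)"
    by (rule has_derivative_transform_within_open[OF has_jetD(2)[OF assms(2,3)]
          has_jet_open[OF assms(1)] assms(3)]) (simp add: eq)
  then show "H x = H' x"
    using has_derivative_unique has_jetD(2)[OF assms(1,3)] by blast
qed

lemma has_jet_cong:
  assumes "has_jet f g H S" "\<And>x. x \<in> S \<Longrightarrow> f x = f' x"
  shows "has_jet f' g H S"
  using assms unfolding has_jet_def
  by (auto intro: has_derivative_transform_within_open)

lemma has_derivative_ln_norm:
  fixes x :: "real^'n::finite"
  assumes "x \<noteq> 0"
  shows "((\<lambda>x. ln (norm x)) has_derivative (\<lambda>v. (x \<bullet> v) / (norm x)\<^sup>2)) (at x)"
  using assms
  by (auto intro!: derivative_eq_intros has_derivative_norm simp: sgn_div_norm inner_commute power2_eq_square fun_eq_iff field_simps)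

text \<open>
  The logarithmic radius is the natural variable: the operator is homogeneous under scaling
  up to the potential, so its radial part has bounded coefficients in \<open>ln (norm x)\<close>.
\<close>

lemma has_jet_radial:
  fixes F F' F'' :: "real \<Rightarrow> real"
  assumes F: "\<And>s. (F has_real_derivative F' s) (at s)"
    and F': "\<And>s. (F' has_real_derivative F'' s) (at s)"
  shows "has_jet (\<lambda>x::real^'n::finite. F (ln (norm x)))
     (\<lambda>x. (F' (ln (norm x)) / (norm x)\<^sup>2) *\<^sub>R x)
     (\<lambda>x v. (F' (ln (norm x)) / (norm x)\<^sup>2) *\<^sub>R v +
        (((F'' (ln (norm x)) - 2 * F' (ln (norm x))) / (norm x)^4) * (x \<bullet> v)) *\<^sub>R x) (-{0})"
  unfolding has_jet_def
proof (intro conjI ballI)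
  show "open (-{0::real^'n})" by (simp add: open_Compl)
next
  fix x :: "real^'n" assume "x \<in> -{0}"
  then have x: "x \<noteq> 0" by simp
  note dl = has_derivative_ln_norm[OF x]
  let ?s = "ln (norm x)" and ?r = "norm x"
  have c: "((\<lambda>x. F (ln (norm x))) has_derivative (\<lambda>v. F' ?s * ((x \<bullet> v) / ?r\<^sup>2))) (at x)"
    using has_derivative_compose[OF dl F[unfolded has_field_derivative_def]] by simp
  have c': "((\<lambda>x. F' (ln (norm x))) has_derivative (\<lambda>v. F'' ?s * ((x \<bullet> v) / ?r\<^sup>2))) (at x)"
    using has_derivative_compose[OF dl F'[unfolded has_field_derivative_def]] by simp
  show "((\<lambda>x. F (ln (norm x))) has_derivative (\<lambda>v. (F' ?s / ?r\<^sup>2) *\<^sub>R x \<bullet> v)) (at x)"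
    using c by (rule has_derivative_eq_rhs) (auto simp: field_simps)
  have n2: "((\<lambda>x. (norm x)\<^sup>2) has_derivative (\<lambda>v. 2 * (x \<bullet> v))) (at x)"
    unfolding power2_norm_eq_inner
    by (auto intro!: derivative_eq_intros simp: inner_commute)
  have r: "?r > 0" using x by simp
  have q: "((\<lambda>x. F' (ln (norm x)) / (norm x)\<^sup>2) has_derivative
      (\<lambda>v. (F'' ?s - 2 * F' ?s) / ?r^4 * (x \<bullet> v))) (at x)"
    using r by (intro has_derivative_eq_rhs[OF has_derivative_divide[OF c' n2]])
      (auto simp: fun_eq_iff field_simps power2_eq_square power4_eq_xxxx)
  show "((\<lambda>x. (F' (ln (norm x)) / (norm x)\<^sup>2) *\<^sub>R x) has_derivative
     (\<lambda>v. (F' ?s / ?r\<^sup>2) *\<^sub>R v + ((F'' ?s - 2 * F' ?s) / ?r^4 * (x \<bullet> v)) *\<^sub>R x)) (at x)"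
    by (rule has_derivative_eq_rhs[OF has_derivative_scaleR[OF q has_derivative_ident]]) simp
qed

lemma lin_trace_simps:
  "lin_trace (\<lambda>v. T v + T' v) = lin_trace T + lin_trace T'"
  "lin_trace (\<lambda>v. T v - T' v) = lin_trace T - lin_trace T'"
  "lin_trace (\<lambda>v. c *\<^sub>R T v) = c * lin_trace T"
  "lin_trace (\<lambda>v. 0) = 0"
  by (simp_all add: lin_trace_def sum.distrib sum_subtractf sum_distrib_left)

lemma lin_trace_id: "lin_trace (\<lambda>v::real^'n::finite. v) = real CARD('n)"
  by (simp add: lin_trace_def)

lemma lin_trace_rank_one: "lin_trace (\<lambda>v. (a \<bullet> v) *\<^sub>R b) = a \<bullet> b"
  by (simp add: lin_trace_def inner_vec_def[of a b] inner_axis)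

text \<open>
  Applied to a reflection \<open>S\<close>, this is the invariance of the Laplacian.
\<close>

lemma lin_trace_conj:
  fixes T :: "real^'n::finite \<Rightarrow> real^'n"
  assumes T: "linear T" and S: "linear S" and inv: "\<And>v. S (S v) = v"
  shows "lin_trace (\<lambda>v. S (T (S v))) = lin_trace T"
proof -
  have tr: "lin_trace A = trace (matrix A)" for A :: "real^'n \<Rightarrow> real^'n"
    by (simp add: lin_trace_def trace_def matrix_def)
  have TS: "linear (T \<circ> S)" using T S by (rule linear_compose[rotated])
  have "lin_trace (\<lambda>v. S (T (S v))) = trace (matrix (S \<circ> (T \<circ> S)))"
    by (simp add: tr o_def)
  also have "\<dots> = trace (matrix (T \<circ> S) ** matrix S)"
    by (subst matrix_compose[OF TS S], subst trace_mul_sym) simp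
  also have "\<dots> = trace (matrix ((T \<circ> S) \<circ> S))"
    by (subst matrix_compose[OF S TS]) simp
  also have "\<dots> = lin_trace T"
    by (simp add: tr o_def inv)
  finally show ?thesis .
qed

lemma local_max_second_deriv_le_0:
  fixes k k' :: "real \<Rightarrow> real"
  assumes d: "d > 0" and k: "\<And>t. \<bar>t\<bar> < d \<Longrightarrow> (k has_real_derivative k' t) (at t)"
    and k': "(k' has_real_derivative l) (at 0)"
    and le: "\<And>t. \<bar>t\<bar> < d \<Longrightarrow> k t \<le> k 0"
  shows "k' 0 = 0" "l \<le> 0"
proof -
  have k0: "(k has_real_derivative k' 0) (at 0)" using k[of 0] d by simp
  show z: "k' 0 = 0"
    by (rule DERIV_local_max[OF k0 d]) (use le in auto)
  show "l \<le> 0"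
  proof (rule ccontr)
    assume "\<not> l \<le> 0"
    then have "l > 0" by simp
    from DERIV_pos_inc_right[OF k' this] obtain e where e: "e > 0" 
      and p: "\<And>h. h > 0 \<Longrightarrow> h < e \<Longrightarrow> k' 0 < k' (0 + h)" by auto
    define b where "b = min d e / 2"
    have b: "0 < b" "b < d" "b < e" using d e unfolding b_def by (auto simp: min_def)
    have "k 0 < k b"
    proof (rule DERIV_pos_imp_increasing_open[OF b(1)])
      show "\<exists>y. (k has_real_derivative y) (at x) \<and> 0 < y" if "0 < x" "x < b" for x
        using k[of x] p[of x] z that b by (intro exI[of _ "k' x"]) auto
      show "continuous_on {0..b} k"
        by (rule DERIV_continuous_on[where D = k'])
           (use b in \<open>auto intro!: has_field_derivative_at_within k\<close>)
    qed
    then show False using le[of b] b by simp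
  qed
qed

text \<open>
  The one-dimensional test, applied along every line through the maximum point.
\<close>

lemma has_jet_local_max:
  assumes j: "has_jet f g H S" and x: "x \<in> S" and max: "\<And>y. y \<in> S \<Longrightarrow> f y \<le> f x"
  shows "g x = 0" "v \<bullet> H x v \<le> 0"
proof -
  obtain d where d: "d > 0" "ball x d \<subseteq> S"
    using has_jet_open[OF j] x by (meson openE)
  have *: "g x \<bullet> w = 0 \<and> w \<bullet> H x w \<le> 0" for w
  proof -
    define d' where "d' = d / (norm w + 1)"
    have d': "d' > 0" using d by (simp add: d'_def add_nonneg_pos)
    have inS: "x + t *\<^sub>R w \<in> S" if "\<bar>t\<bar> < d'" for t
    proof -
      have "\<bar>t\<bar> * norm w \<le> \<bar>t\<bar> * (norm w + 1)" by (simp add: mult_left_mono)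
      also have "\<dots> < d"
        using that by (subst (asm) d'_def, subst (asm) pos_less_divide_eq) (auto simp: add_nonneg_pos)
      finally show ?thesis using d(2) by (auto simp: dist_norm)
    qed
    have lin: "((\<lambda>t. x + t *\<^sub>R w) has_derivative (\<lambda>h. h *\<^sub>R w)) (at t)" for t
      by (auto intro!: derivative_eq_intros)
    have k: "((\<lambda>t. f (x + t *\<^sub>R w)) has_real_derivative (g (x + t *\<^sub>R w) \<bullet> w)) (at t)"
      if "\<bar>t\<bar> < d'" for t
      using has_derivative_compose[OF lin has_jetD(1)[OF j inS[OF that]]]
      unfolding has_field_derivative_def
      by (rule has_derivative_eq_rhs) (auto simp: fun_eq_iff)
    have "((\<lambda>t. g (x + t *\<^sub>R w)) has_derivative (\<lambda>h. H x (h *\<^sub>R w))) (at 0)"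
      by (rule has_derivative_compose[OF lin]) (use has_jetD(2)[OF j x] in simp)
    then have "((\<lambda>t. g (x + t *\<^sub>R w) \<bullet> w) has_derivative (\<lambda>h. H x (h *\<^sub>R w) \<bullet> w)) (at 0)"
      by (rule has_derivative_inner_left)
    moreover have "H x (h *\<^sub>R w) = h *\<^sub>R H x w" for h
      using has_jetD(3)[OF j x] by (simp add: bounded_linear.linear linear_cmul)
    ultimately have k': "((\<lambda>t. g (x + t *\<^sub>R w) \<bullet> w) has_real_derivative (w \<bullet> H x w)) (at 0)"
      unfolding has_field_derivative_def
      by (auto elim!: has_derivative_eq_rhs simp: fun_eq_iff inner_commute)
    show ?thesis
      using local_max_second_deriv_le_0[OF d' k k'] max inS by auto
  qed
  from * have "g x \<bullet> g x = 0" by blast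
  then show "g x = 0" by simp
  show "v \<bullet> H x v \<le> 0" using * by blast
qed

lemma lin_trace_nonpos:
  assumes "\<And>v. v \<bullet> T v \<le> 0" shows "lin_trace T \<le> 0"
  unfolding lin_trace_def
  by (rule sum_nonpos) (metis assms cart_eq_inner_axis inner_commute)

section \<open>Partial derivatives and the bubble\<close>

text \<open>
  Identifies a derivative with the gradient assembled from its values on the axes.
\<close>

lemma linear_eq_sum_axis:
  fixes D :: "real^'n::finite \<Rightarrow> real"
  assumes "linear D"
  shows "D v = (\<chi> i. D (axis i 1)) \<bullet> v"
proof -
  have "D v = D (\<Sum>i\<in>UNIV. v $ i *\<^sub>R axis i 1)"
    using basis_expansion[of v] by (simp add: scalar_mult_eq_scaleR)
  also have "\<dots> = (\<Sum>i\<in>UNIV. v $ i *\<^sub>R D (axis i 1))"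
    using assms by (simp add: linear_sum linear_cmul)
  finally show ?thesis by (simp add: inner_vec_def mult.commute)
qed

lemma partial_deriv_eq:
  fixes f :: "real^'n::finite \<Rightarrow> real"
  assumes "(f has_derivative D) (at x)"
  shows "partial_deriv i f x = D (axis i 1)"
proof -
  have lin: "((\<lambda>t. x + t *\<^sub>R axis i 1) has_derivative (\<lambda>h. h *\<^sub>R axis i 1)) (at 0)"
    by (auto intro!: derivative_eq_intros)
  have "((\<lambda>t. f (x + t *\<^sub>R axis i 1)) has_derivative (\<lambda>h. D (h *\<^sub>R axis i 1))) (at 0)"
    by (rule has_derivative_compose[OF lin]) (use assms in simp)
  moreover have "D (h *\<^sub>R axis i 1) = D (axis i 1) * h" for h
    using has_derivative_linear[OF assms] by (simp add: linear_cmul)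
  ultimately have "((\<lambda>t. f (x + t *\<^sub>R axis i 1)) has_real_derivative D (axis i 1)) (at 0)"
    by (simp add: has_field_derivative_def)
  then show ?thesis unfolding partial_deriv_def by (rule DERIV_imp_deriv)
qed

lemma divergence_eq:
  assumes "(F has_derivative D) (at x)"
  shows "divergence F x = lin_trace D"
  unfolding divergence_def lin_trace_def
proof (rule sum.cong[OF refl])
  fix i
  have "((\<lambda>y. F y $ i) has_derivative (\<lambda>v. D v $ i)) (at x)"
    using assms by (rule bounded_linear.has_derivative[OF bounded_linear_vec_nth])
  then show "partial_deriv i (\<lambda>y. F y $ i) x = D (axis i 1) $ i"
    by (rule partial_deriv_eq)
qed

lemma grad_eq:
  assumes "has_jet f g H S" "x \<in> S"
  shows "grad f x = g x"
  unfolding grad_def partial_deriv_eq[OF has_jetD(1)[OF assms]]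
  by (simp add: vec_eq_iff inner_axis)

lemma C1_has_derivative:
  assumes "C1 f"
  shows "(f has_derivative (\<lambda>v. grad f x \<bullet> v)) (at x)"
proof -
  obtain D where D: "(f has_derivative D) (at x)"
    using assms unfolding C1_def differentiable_def by blast
  have "D = (\<lambda>v. grad f x \<bullet> v)"
    unfolding grad_def partial_deriv_eq[OF D]
    using linear_eq_sum_axis[OF has_derivative_linear[OF D]] by blast
  then show ?thesis using D by simp
qed

lemma C1_continuous_grad: "C1 f \<Longrightarrow> continuous_on UNIV (grad f)"
  unfolding grad_def C1_def by (auto intro: continuous_on_vec_lambda)

lemma has_derivative_vec_lambda_components:
  fixes D :: "'n::finite \<Rightarrow> 'a::euclidean_space \<Rightarrow> real"
  assumes "\<And>i. (f i has_derivative D i) (at x)"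
  shows "((\<lambda>x. \<chi> i. f i x) has_derivative (\<lambda>v. \<chi> i. D i v)) (at x)"
  by (subst has_derivative_componentwise_within)
     (auto simp: Basis_vec_def inner_axis assms)

lemma C2_has_jet:
  assumes "C2 f"
  shows "has_jet f (grad f) (\<lambda>x v. \<chi> i. grad (partial_deriv i f) x \<bullet> v) UNIV"
proof (rule has_jetI)
  show "(f has_derivative (\<lambda>v. grad f x \<bullet> v)) (at x)" for x
    using assms by (auto simp: C2_def intro: C1_has_derivative)
  show "(grad f has_derivative (\<lambda>v. \<chi> i. grad (partial_deriv i f) x \<bullet> v)) (at x)" for x
    unfolding grad_def[of f]
    using assms by (auto simp: C2_def intro!: has_derivative_vec_lambda_components C1_has_derivative)
qed auto

text \<open>
  The Hoelder conjugate of \<open>n\<close>, the exponent of \<open>norm x\<close> in \<open>liouville_U\<close>.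
\<close>

definition dual_exp :: "nat \<Rightarrow> real" where
  "dual_exp n = real n / (real n - 1)"

text \<open>
  In terms of the radius \<open>r = exp s\<close> this is \<open>r powr q / (1 + r powr q)\<close>. All coefficients
  below are polynomials in it.
\<close>

definition profile :: "nat \<Rightarrow> real \<Rightarrow> real" where
  "profile n s = exp (dual_exp n * s) / (1 + exp (dual_exp n * s))"

lemma profile_bounds: "0 < profile n s" "profile n s < 1"
  by (simp_all add: profile_def add_pos_pos)

lemma one_minus_profile: "1 - profile n s = 1 / (1 + exp (dual_exp n * s))"
proof -
  have "1 + exp (dual_exp n * s) > 0" by (simp add: add_pos_pos)
  then show ?thesis by (simp add: profile_def field_simps)
qed

lemma DERIV_profile [derivative_intros]:
  assumes "(f has_real_derivative D) (at x within A)"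
  shows "((\<lambda>x. profile n (f x)) has_real_derivative
      (dual_exp n * profile n (f x) * (1 - profile n (f x)) * D)) (at x within A)"
proof -
  have p: "1 + exp (dual_exp n * s) > 0" for s by (simp add: add_pos_pos)
  have "(profile n has_real_derivative dual_exp n * profile n s * (1 - profile n s)) (at s)" for s
    unfolding profile_def using p[of s]
    by (auto intro!: derivative_eq_intros simp: field_simps)
  from DERIV_chain'[OF assms this] show ?thesis by (simp add: mult_ac)
qed

lemma liouville_const_pos: "n \<ge> 2 \<Longrightarrow> liouville_const n > 0"
  by (auto simp: liouville_const_def intro!: mult_pos_pos zero_less_power divide_pos_pos)

lemma liouville_U_eq:
  fixes x :: "real^'n::finite"
  assumes "CARD('n) \<ge> 2" "x \<noteq> 0"
  shows "liouville_U x = ln (liouville_const CARD('n))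
     - real CARD('n) * ln (1 + exp (dual_exp CARD('n) * ln (norm x)))"
proof -
  have "norm x powr (real CARD('n) / (real CARD('n) - 1)) = exp (dual_exp CARD('n) * ln (norm x))"
    using assms by (simp add: powr_def dual_exp_def)
  moreover have "1 + exp (dual_exp CARD('n) * ln (norm x)) > 0" by (simp add: add_pos_pos)
  ultimately show ?thesis
    unfolding liouville_U_def using liouville_const_pos[OF assms(1)]
    by (simp add: ln_div ln_realpow)
qed

lemma has_derivative_radial:
  fixes F :: "real \<Rightarrow> real" and x :: "real^'n::finite"
  assumes "\<And>s. (F has_real_derivative F' s) (at s)" "x \<noteq> 0"
  shows "((\<lambda>x. F (ln (norm x))) has_derivative (\<lambda>v. F' (ln (norm x)) * ((x \<bullet> v) / (norm x)\<^sup>2))) (at x)"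
  using has_derivative_compose[OF has_derivative_ln_norm[OF assms(2)] assms(1)[unfolded has_field_derivative_def]]
  by simp

lemma grad_liouville_U:
  fixes x :: "real^'n::finite"
  assumes N: "CARD('n) \<ge> 2" and x: "x \<noteq> 0"
  shows "grad liouville_U x =
    - (real CARD('n) * dual_exp CARD('n) * profile CARD('n) (ln (norm x)) / (norm x)\<^sup>2) *\<^sub>R x"
proof -
  let ?n = "CARD('n)"
  define F where "F = (\<lambda>s. ln (liouville_const ?n) - real ?n * ln (1 + exp (dual_exp ?n * s)))"
  define F' where "F' = (\<lambda>s. - (real ?n * dual_exp ?n * profile ?n s))"
  have p: "1 + exp (dual_exp ?n * s) > 0" for s by (simp add: add_pos_pos)
  have F: "(F has_real_derivative F' s) (at s)" for s
    unfolding F_def F'_def profile_def using p[of s]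
    by (auto intro!: derivative_eq_intros)
  have U: "F (ln (norm y)) = liouville_U y" if "y \<in> -{0}" for y :: "real^'n"
    using that liouville_U_eq[OF N, of y] by (simp add: F_def)
  have "((\<lambda>y. F (ln (norm y))) has_derivative (\<lambda>v. F' (ln (norm x)) * ((x \<bullet> v) / (norm x)\<^sup>2))) (at x)"
    by (rule has_derivative_radial[OF F x])
  moreover have "open (-{0::real^'n})" "x \<in> -{0}" using x by (simp_all add: open_Compl)
  ultimately have "(liouville_U has_derivative (\<lambda>v. F' (ln (norm x)) * ((x \<bullet> v) / (norm x)\<^sup>2))) (at x)"
    using U by (rule has_derivative_transform_within_open)
  from partial_deriv_eq[OF this] show ?thesis
    by (simp add: grad_def vec_eq_iff inner_axis F'_def)
qed

text \<open>
  The bubble is \<open>C - N ln (1 + \<bar>t\<bar> powr q)\<close> on each axis, and \<open>q > 1\<close> makes its derivative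
  at 0 vanish.
\<close>

lemma grad_liouville_U_0:
  assumes "CARD('n::finite) \<ge> 2"
  shows "grad liouville_U (0::real^'n) = 0"
proof -
  let ?q = "dual_exp CARD('n)" and ?n = "real CARD('n)"
  have q: "?q > 1" using assms by (simp add: dual_exp_def field_simps)
  have "partial_deriv i liouville_U (0::real^'n) = 0" for i :: 'n
  proof -
    have "((\<lambda>h::real. \<bar>h\<bar> powr (?q - 1)) \<longlongrightarrow> 0) (at 0)"
      by (rule tendsto_zero_powrI[where b = "?q - 1"]) (use q in \<open>auto intro!: tendsto_eq_intros\<close>)
    then have "((\<lambda>h::real. \<bar>h\<bar> powr ?q / h) \<longlongrightarrow> 0) (at 0)"
    proof (rule Lim_null_comparison[rotated])
      show "\<forall>\<^sub>F h in at 0. norm (\<bar>h\<bar> powr ?q / h) \<le> \<bar>h\<bar> powr (?q - 1)"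
        by (auto simp: eventually_at_filter powr_diff)
    qed
    then have d: "((\<lambda>h::real. \<bar>h\<bar> powr ?q) has_real_derivative 0) (at 0)"
      by (simp add: DERIV_def)
    have e: "liouville_U (0 + t *\<^sub>R axis i 1) = ln (liouville_const CARD('n)) - ?n * ln (1 + \<bar>t\<bar> powr ?q)" for t
    proof -
      have "1 + \<bar>t\<bar> powr ?q > 0" by (simp add: add_pos_nonneg)
      then show ?thesis
        unfolding liouville_U_def using liouville_const_pos[OF assms]
        by (simp add: ln_div ln_realpow dual_exp_def norm_axis_1)
    qed
    have "((\<lambda>t. ln (liouville_const CARD('n)) - ?n * ln (1 + \<bar>t\<bar> powr ?q)) has_real_derivative 0) (at 0)"
      by (rule DERIV_cong[OF DERIV_diff[OF DERIV_const DERIV_cmult[OF DERIV_chain'[OF DERIV_add[OF DERIV_const d] DERIV_ln]]]]) auto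
    then show ?thesis unfolding partial_deriv_def e by (rule DERIV_imp_deriv)
  qed
  then show ?thesis by (simp add: grad_def vec_eq_iff)
qed

section \<open>The linearized operator off the origin\<close>

text \<open>
  The expanded form of the linearized operator, divided by its positive leading weight, in
  terms of the value \<open>c\<close>, the gradient \<open>g\<close> and the Hessian \<open>T\<close> of a function at \<open>x\<close>.
\<close>

definition liouville_op :: "real^'n::finite \<Rightarrow> real \<Rightarrow> real^'n \<Rightarrow> (real^'n \<Rightarrow> real^'n) \<Rightarrow> real" where
  "liouville_op x c g T =
     (norm x)\<^sup>2 * lin_trace T + (real CARD('n) - 2) * (x \<bullet> T x)
     + real CARD('n) * (real CARD('n) - 2) * (1 - profile CARD('n) (ln (norm x))) * (x \<bullet> g)
     + (real CARD('n))\<^sup>2 * dual_exp CARD('n) * profile CARD('n) (ln (norm x))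
        * (1 - profile CARD('n) (ln (norm x))) * c"

text \<open>
  The normalising constant of the bubble is chosen so that the potential \<open>exp U\<close>, measured
  against the weight \<open>norm (grad U) ^ (N - 2) / r\<^sup>2\<close>, is quadratic in the profile. The
  identity behind it is \<open>(r powr q) ^ (N - 1) = r ^ N\<close>.
\<close>

lemma exp_liouville_U:
  fixes x :: "real^'n::finite"
  assumes "CARD('n) \<ge> 2" "x \<noteq> 0"
  shows "exp (liouville_U x) =
     (real CARD('n) * dual_exp CARD('n) * profile CARD('n) (ln (norm x)) * exp (- ln (norm x))) ^ (CARD('n) - 2)
     / (norm x)\<^sup>2 * ((real CARD('n))\<^sup>2 * dual_exp CARD('n) * profile CARD('n) (ln (norm x))
        * (1 - profile CARD('n) (ln (norm x))))"
proof -
  obtain m where m: "CARD('n) = Suc (Suc m)"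
    using assms(1) by (metis add_2_eq_Suc le_Suc_ex)
  let ?N = "CARD('n)" and ?r = "norm x" and ?s = "ln (norm x)"
  let ?q = "dual_exp ?N"
  define E where "E = exp (?q * ?s)"
  have E: "E > 0" "1 + E > 0" by (simp_all add: E_def add_pos_pos)
  have r: "?r > 0" using assms by simp
  have Er: "E ^ Suc m = ?r ^ Suc (Suc m)"
  proof -
    have "real (Suc m) * (?q * ?s) = real (Suc (Suc m)) * ?s"
      by (simp add: dual_exp_def m field_simps)
    then have "E ^ Suc m = exp (real (Suc (Suc m)) * ?s)"
      unfolding E_def by (metis exp_of_nat_mult)
    also have "\<dots> = ?r ^ Suc (Suc m)" using r by (metis exp_ln exp_of_nat_mult)
    finally show ?thesis .
  qed
  have C: "liouville_const ?N = real ?N * (real ?N * ?q) ^ Suc m"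
    by (simp add: liouville_const_def dual_exp_def m power2_eq_square)
  have "exp (liouville_U x) = liouville_const ?N / (1 + E) ^ ?N"
  proof -
    have "exp (real ?N * ln (1 + E)) = (1 + E) ^ ?N"
      using E by (simp add: exp_of_nat_mult)
    then show ?thesis
      unfolding liouville_U_eq[OF assms] E_def[symmetric] exp_diff
      using liouville_const_pos[OF assms(1)] by simp
  qed
  moreover have "(real ?N * ?q * (E / (1 + E)) * (1 / ?r)) ^ m / ?r\<^sup>2 * ((real ?N)\<^sup>2 * ?q * (E / (1 + E)) * (1 / (1 + E)))
     = real ?N * (real ?N * ?q) ^ Suc m * (E ^ Suc m / ?r ^ Suc (Suc m)) / (1 + E) ^ Suc (Suc m)"
    using r E by (simp add: power_mult_distrib power_divide power2_eq_square divide_simps)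
  moreover have "E ^ Suc m / ?r ^ Suc (Suc m) = 1" using r Er by simp
  moreover have "profile ?N ?s = E / (1 + E)" by (simp add: profile_def E_def)
  moreover have "1 - profile ?N ?s = 1 / (1 + E)" by (simp add: one_minus_profile E_def)
  moreover have "exp (- ?s) = 1 / ?r" using r by (simp add: exp_minus inverse_eq_divide)
  moreover have "CARD('n) - 2 = m" using m by simp
  ultimately show ?thesis by (simp only: C[unfolded m] m)
qed

lemma DERIV_weight:
  assumes "n \<ge> 2"
  shows "((\<lambda>s. (c * profile n s * exp (- s)) ^ (n - 2)) has_real_derivative
     (real n - 2) * (dual_exp n * (1 - profile n s) - 1) * (c * profile n s * exp (- s)) ^ (n - 2)) (at s)"
proof (cases "n = 2")
  case False
  then obtain m where m: "n = Suc (Suc (Suc m))"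
    using assms by (metis One_nat_def add_2_eq_Suc le_Suc_ex not0_implies_Suc numeral_2_eq_2 add_0_right)
  define f where "f = (\<lambda>s. c * profile n s * exp (- s))"
  have f: "(f has_real_derivative (dual_exp n * (1 - profile n s) - 1) * f s) (at s)"
    unfolding f_def by (auto intro!: derivative_eq_intros simp: algebra_simps)
  have "((\<lambda>s. f s ^ (n - 2)) has_real_derivative
     (real n - 2) * (dual_exp n * (1 - profile n s) - 1) * f s ^ (n - 2)) (at s)"
    using DERIV_power[OF f, of "n - 2"] by (simp add: m mult_ac)
  then show ?thesis unfolding f_def .
qed simp

text \<open>
  Both vector fields are explicit near \<open>x\<close>: the first is \<open>A g\<close> and the second
  \<open>(A / r\<^sup>2) (y \<bullet> g) y\<close> at a point \<open>y\<close> of norm \<open>r\<close>, with the radial weight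
  \<open>A = norm (grad U) ^ (N - 2)\<close>, because the gradient of the bubble is a multiple of the
  position vector. Their divergences are traces of derivatives.
\<close>

lemma linearized_op_eq:
  fixes x :: "real^'n::finite"
  assumes N: "CARD('n) \<ge> 2" and j: "has_jet \<phi> g H (-{0})" and x: "x \<noteq> 0"
  shows "linearized_op \<phi> x =
     (real CARD('n) * dual_exp CARD('n) * profile CARD('n) (ln (norm x)) * exp (- ln (norm x))) ^ (CARD('n) - 2)
     / (norm x)\<^sup>2 * liouville_op x (\<phi> x) (g x) (H x)"
proof -
  let ?N = "real CARD('n)" and ?r = "norm x" and ?q = "dual_exp CARD('n)"
  define Y where "Y = (\<lambda>s. profile CARD('n) s)"
  define A where "A s = (?N * ?q * Y s * exp (- s)) ^ (CARD('n) - 2)" for s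
  define A' where "A' s = (?N - 2) * (?q * (1 - Y s) - 1) * A s" for s
  have q: "?q > 0" using N by (simp add: dual_exp_def)
  have dA: "(A has_real_derivative A' s) (at s)" for s
    unfolding A_def A'_def Y_def by (rule DERIV_weight[OF N])
  have dB: "((\<lambda>s. A s * exp (- 2 * s)) has_real_derivative (A' s - 2 * A s) * exp (- 2 * s)) (at s)" for s
    by (auto intro!: derivative_eq_intros dA simp: algebra_simps)
  have e2: "exp (- 2 * ln (norm y)) = 1 / (norm y)\<^sup>2" if "y \<noteq> 0" for y :: "real^'n"
  proof -
    have "exp (- 2 * ln (norm y)) = inverse (exp (ln (norm y)) * exp (ln (norm y)))"
      by (simp flip: exp_add exp_minus)
    then show ?thesis using that by (simp add: inverse_eq_divide power2_eq_square)
  qed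
  have r: "?r > 0" using x by simp
  have m: "norm (grad liouville_U y) = ?N * ?q * Y (ln (norm y)) * exp (- ln (norm y))"
    if "y \<noteq> 0" for y :: "real^'n"
    using that q profile_bounds[of "CARD('n)" "ln (norm y)"]
    by (simp add: grad_liouville_U[OF N that] Y_def exp_minus power2_eq_square field_simps abs_mult)
  have field1: "(norm (grad liouville_U y) powi (int CARD('n) - 2)) *\<^sub>R grad \<phi> y = A (ln (norm y)) *\<^sub>R g y"
    if "y \<in> -{0}" for y
  proof -
    have "int CARD('n) - 2 = int (CARD('n) - 2)" using N by simp
    then show ?thesis using that by (simp only: m A_def grad_eq[OF j that] power_int_of_nat) (simp add: m A_def)
  qed
  have field2: "(norm (grad liouville_U y) powi (int CARD('n) - 4) * (grad liouville_U y \<bullet> grad \<phi> y)) *\<^sub>R grad liouville_U y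
     = (A (ln (norm y)) * exp (- 2 * ln (norm y)) * (y \<bullet> g y)) *\<^sub>R y"
    if y: "y \<in> -{0}" for y
  proof -
    let ?m = "?N * ?q * Y (ln (norm y)) * exp (- ln (norm y))"
    have y0: "y \<noteq> 0" using y by simp
    have mp: "?m > 0" using q N profile_bounds[of "CARD('n)" "ln (norm y)"] by (simp add: Y_def)
    have "?m powi (int CARD('n) - 4) = ?m powi (int (CARD('n) - 2) - int 2)"
      using N by (simp add: of_nat_diff)
    also have "\<dots> = A (ln (norm y)) / ?m\<^sup>2"
      using mp unfolding A_def by (subst power_int_diff) (auto simp: power_int_of_nat)
    finally have 1: "norm (grad liouville_U y) powi (int CARD('n) - 4) = A (ln (norm y)) / ?m\<^sup>2"
      using m[OF y0] by simp
    define k where "k = ?N * ?q * Y (ln (norm y)) / (norm y)\<^sup>2"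
    have k: "k > 0" using q N profile_bounds[of "CARD('n)" "ln (norm y)"] y0 by (simp add: Y_def k_def)
    have G: "grad liouville_U y = (- k) *\<^sub>R y"
      using grad_liouville_U[OF N y0] by (simp add: k_def Y_def)
    have mk: "?m = k * norm y"
      using y0 by (simp add: k_def exp_minus power2_eq_square inverse_eq_divide)
    have ee: "exp (- 2 * ln (norm y)) = 1 / (norm y)\<^sup>2" by (rule e2[OF y0])
    have "A (ln (norm y)) / (k * norm y)\<^sup>2 * (- k * (y \<bullet> g y)) * - k = A (ln (norm y)) * (1 / (norm y)\<^sup>2) * (y \<bullet> g y)"
      using k by (simp add: power2_eq_square)
    then show ?thesis
      unfolding 1 mk grad_eq[OF j y] ee unfolding G inner_scaleR_left scaleR_scaleR by simp
  qed
  have xS: "x \<in> -{0}" using x by simp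
  have oS: "open (-{0::real^'n})" by (simp add: open_Compl)
  have d1: "((\<lambda>y. A (ln (norm y)) *\<^sub>R g y) has_derivative
     (\<lambda>v. A (ln ?r) *\<^sub>R H x v + (A' (ln ?r) * ((x \<bullet> v) / ?r\<^sup>2)) *\<^sub>R g x)) (at x)"
    by (rule has_derivative_scaleR[OF has_derivative_radial[OF dA x] has_jetD(2)[OF j xS]])
  have div1: "divergence (\<lambda>y. (norm (grad liouville_U y) powi (int CARD('n) - 2)) *\<^sub>R grad \<phi> y) x
     = A (ln ?r) * lin_trace (H x) + A' (ln ?r) / ?r\<^sup>2 * (x \<bullet> g x)"
  proof -
    have "((\<lambda>y. (norm (grad liouville_U y) powi (int CARD('n) - 2)) *\<^sub>R grad \<phi> y) has_derivative
     (\<lambda>v. A (ln ?r) *\<^sub>R H x v + (A' (ln ?r) / ?r\<^sup>2) *\<^sub>R ((x \<bullet> v) *\<^sub>R g x))) (at x)"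
      by (rule has_derivative_transform_within_open[OF has_derivative_eq_rhs[OF d1] oS xS])
         (auto simp: field1 fun_eq_iff)
    from divergence_eq[OF this] show ?thesis
      by (simp only: lin_trace_simps lin_trace_rank_one)
  qed
  let ?B = "A (ln ?r) / ?r\<^sup>2"
  have d2: "((\<lambda>y. (A (ln (norm y)) * exp (- 2 * ln (norm y)) * (y \<bullet> g y)) *\<^sub>R y) has_derivative
     (\<lambda>v. (?B * (x \<bullet> g x)) *\<^sub>R v + (?B * (x \<bullet> H x v + v \<bullet> g x)
        + (A' (ln ?r) - 2 * A (ln ?r)) / ?r\<^sup>2 * ((x \<bullet> v) / ?r\<^sup>2) * (x \<bullet> g x)) *\<^sub>R x)) (at x)"
    by (rule has_derivative_eq_rhs[OF has_derivative_scaleR[OF has_derivative_mult[OF has_derivative_radial[OF dB x]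
          has_derivative_inner[OF has_derivative_ident has_jetD(2)[OF j xS]]] has_derivative_ident]])
       (unfold e2[OF x], rule ext, rule arg_cong2[where f = "(+)"], simp,
        rule arg_cong[where f = "\<lambda>c. c *\<^sub>R x"], simp)
  have tr2: "lin_trace (\<lambda>v. (x \<bullet> H x v) *\<^sub>R x) = x \<bullet> H x x"
  proof -
    have "lin_trace (\<lambda>v. (x \<bullet> H x v) *\<^sub>R x) = (\<chi> i. x \<bullet> H x (axis i 1)) \<bullet> x"
      by (simp add: lin_trace_def inner_vec_def)
    also have "\<dots> = x \<bullet> H x x"
      by (rule linear_eq_sum_axis[OF bounded_linear.linear[OF
            bounded_linear_compose[OF bounded_linear_inner_right has_jetD(3)[OF j xS]]], symmetric])
    finally show ?thesis .
  qed
  have div2: "divergence (\<lambda>y. (norm (grad liouville_U y) powi (int CARD('n) - 4) *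
                        (grad liouville_U y \<bullet> grad \<phi> y)) *\<^sub>R grad liouville_U y) x
     = ?B * (x \<bullet> H x x) + (?B * (?N - 1) + A' (ln ?r) / ?r\<^sup>2) * (x \<bullet> g x)"
  proof -
    have "((\<lambda>y. (norm (grad liouville_U y) powi (int CARD('n) - 4) *
                        (grad liouville_U y \<bullet> grad \<phi> y)) *\<^sub>R grad liouville_U y) has_derivative
     (\<lambda>v. (?B * (x \<bullet> g x)) *\<^sub>R v + (?B *\<^sub>R ((x \<bullet> H x v) *\<^sub>R x) + (?B *\<^sub>R ((g x \<bullet> v) *\<^sub>R x)
        + ((A' (ln ?r) - 2 * A (ln ?r)) / ?r\<^sup>2 / ?r\<^sup>2 * (x \<bullet> g x)) *\<^sub>R ((x \<bullet> v) *\<^sub>R x))))) (at x)"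
    proof (rule has_derivative_transform_within_open[OF has_derivative_eq_rhs[OF d2] oS xS])
      have *: "?B * (a + b) + c = ?B * a + (?B * b + c)" for a b c by (simp add: distrib_left)
      show "(\<lambda>v. (?B * (x \<bullet> g x)) *\<^sub>R v + (?B * (x \<bullet> H x v + v \<bullet> g x)
        + (A' (ln ?r) - 2 * A (ln ?r)) / ?r\<^sup>2 * ((x \<bullet> v) / ?r\<^sup>2) * (x \<bullet> g x)) *\<^sub>R x)
        = (\<lambda>v. (?B * (x \<bullet> g x)) *\<^sub>R v + (?B *\<^sub>R ((x \<bullet> H x v) *\<^sub>R x) + (?B *\<^sub>R ((g x \<bullet> v) *\<^sub>R x)
        + ((A' (ln ?r) - 2 * A (ln ?r)) / ?r\<^sup>2 / ?r\<^sup>2 * (x \<bullet> g x)) *\<^sub>R ((x \<bullet> v) *\<^sub>R x))))"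
        unfolding scaleR_scaleR scaleR_add_left[symmetric] * inner_commute[of _ "g x"]
        by (simp add: mult_ac)
    qed (simp add: field2)
    from divergence_eq[OF this] have
      "divergence (\<lambda>y. (norm (grad liouville_U y) powi (int CARD('n) - 4) *
                        (grad liouville_U y \<bullet> grad \<phi> y)) *\<^sub>R grad liouville_U y) x
       = ?B * (x \<bullet> g x) * ?N + (?B * (x \<bullet> H x x) + (?B * (x \<bullet> g x)
          + (A' (ln ?r) - 2 * A (ln ?r)) / ?r\<^sup>2 / ?r\<^sup>2 * (x \<bullet> g x) * ?r\<^sup>2))"
      by (simp only: lin_trace_simps lin_trace_rank_one lin_trace_id tr2 inner_commute[of "g x" x] power2_norm_eq_inner)
    also have "\<dots> = ?B * (x \<bullet> H x x) + (?B * (?N - 1) + A' (ln ?r) / ?r\<^sup>2) * (x \<bullet> g x)"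
      using r by (simp add: field_simps power2_eq_square)
    finally show ?thesis .
  qed
  have ex: "exp (liouville_U x) = ?B * (?N\<^sup>2 * ?q * Y (ln ?r) * (1 - Y (ln ?r)))"
    unfolding exp_liouville_U[OF N x] A_def Y_def by simp
  have qN: "?q * (?N - 1) = ?N" using N by (simp add: dual_exp_def)
  have A2: "A' (ln ?r) / ?r\<^sup>2 = ?B * ((?N - 2) * (?q * (1 - Y (ln ?r)) - 1))"
    by (simp add: A'_def)
  define T where "T = lin_trace (H x)"
  define a where "a = x \<bullet> H x x"
  define b where "b = x \<bullet> g x"
  define z where "z = 1 - Y (ln ?r)"
  define k where "k = ?B"
  have AB: "A (ln ?r) = k * ?r\<^sup>2" using r by (simp add: k_def)
  have kk: "k * ?r\<^sup>2 / ?r\<^sup>2 = k" using r by simp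
  have "linearized_op \<phi> x = k * (?r\<^sup>2 * T + (?N - 2) * a
     + ((?N - 2) * (?q * z - 1) + (?N - 2) * ((?N - 1) + (?N - 2) * (?q * z - 1))) * b
     + ?N\<^sup>2 * ?q * Y (ln ?r) * z * \<phi> x)"
    unfolding linearized_op_def div1 div2 ex A2 T_def[symmetric] a_def[symmetric] b_def[symmetric] z_def[symmetric]
    unfolding k_def[symmetric] unfolding AB kk
    by algebra
  also have "(?N - 2) * (?q * z - 1) + (?N - 2) * ((?N - 1) + (?N - 2) * (?q * z - 1)) = (?N - 2) * (?q * (?N - 1)) * z"
    by algebra
  also have "(?N - 2) * (?q * (?N - 1)) * z = ?N * (?N - 2) * z" by (simp add: qN)
  finally show ?thesis
    unfolding liouville_op_def k_def A_def Y_def T_def a_def b_def z_def by simp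
qed

lemma liouville_op_eq_0:
  fixes x :: "real^'n::finite"
  assumes N: "CARD('n) \<ge> 2" and j: "has_jet \<phi> g H (-{0})" and x: "x \<noteq> 0"
    and z: "linearized_op \<phi> x = 0"
  shows "liouville_op x (\<phi> x) (g x) (H x) = 0"
proof -
  have "dual_exp CARD('n) > 0" using N by (simp add: dual_exp_def)
  then show ?thesis
    using linearized_op_eq[OF N j x] z x N profile_bounds(1)[of "CARD('n)" "ln (norm x)"] by auto
qed

section \<open>Radial profiles and the barrier profile\<close>

text \<open>
  The action of \<open>liouville_op\<close> on a radial function of \<open>s = ln r\<close> times a spherical harmonic
  for the eigenvalue \<open>l\<close> of minus the spherical Laplacian; \<open>f0\<close>, \<open>f1\<close>, \<open>f2\<close> are the values
  of the profile and its derivatives at \<open>s\<close>.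
\<close>

definition radial_op :: "nat \<Rightarrow> real \<Rightarrow> real \<Rightarrow> real \<Rightarrow> real \<Rightarrow> real \<Rightarrow> real" where
  "radial_op n l s f0 f1 f2 =
     (real n - 1) * f2 + real n * (real n - 2) * (1 - profile n s) * f1
     + ((real n)\<^sup>2 * dual_exp n * profile n s * (1 - profile n s) - l) * f0"

lemma dual_exp_gt_1: "n \<ge> 2 \<Longrightarrow> dual_exp n > 1"
  by (simp add: dual_exp_def field_simps)

lemma dual_exp_mult: "n \<ge> 2 \<Longrightarrow> dual_exp n * (real n - 1) = real n"
  by (simp add: dual_exp_def)

text \<open>
  The radial factor \<open>w = y / r\<close> of the dipoles solves the equation for the eigenvalue
  \<open>N - 1\<close>. Hence on a multiple \<open>w b\<close> (with \<open>b0\<close>, \<open>b1\<close>, \<open>b2\<close> the jet of \<open>b\<close>) the operator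
  contains derivatives of \<open>b\<close> only. The other coefficients in the statement are the
  derivatives of \<open>w b\<close> from \<open>DERIV_first_harmonic\<close>.
\<close>

lemma radial_op_first_harmonic:
  fixes n :: nat and s b0 b1 b2 :: real
  defines "y \<equiv> profile n s" and "q \<equiv> dual_exp n"
  defines "w \<equiv> y * exp (- s)"
  assumes n: "n \<ge> 2"
  shows "radial_op n (real n - 1) s (w * b0) (w * (q * (1 - y) - 1) * b0 + w * b1)
     (w * ((q * (1 - y) - 1)\<^sup>2 - q\<^sup>2 * y * (1 - y)) * b0 + 2 * (w * (q * (1 - y) - 1)) * b1 + w * b2)
   = (real n - 1) * w * (b2 + (real n * q * (1 - y) - 2) * b1)"
proof -
  have qn: "real n = q * (real n - 1)" using dual_exp_mult[OF n] by (simp add: q_def)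
  define m where "m = real n - 1"
  have N: "real n = q * m" and N1: "real n = m + 1" using qn by (auto simp: m_def)
  have qm: "q * m = m + 1" using N N1 by simp
  have "radial_op n (real n - 1) s (w * b0) (w * (q * (1 - y) - 1) * b0 + w * b1)
     (w * ((q * (1 - y) - 1)\<^sup>2 - q\<^sup>2 * y * (1 - y)) * b0 + 2 * (w * (q * (1 - y) - 1)) * b1 + w * b2)
     = m * (w * ((q * (1 - y) - 1)\<^sup>2 - q\<^sup>2 * y * (1 - y)) * b0 + 2 * (w * (q * (1 - y) - 1)) * b1 + w * b2)
      + (m + 1) * (m - 1) * (1 - y) * (w * (q * (1 - y) - 1) * b0 + w * b1)
      + ((m + 1)\<^sup>2 * q * y * (1 - y) - m) * (w * b0)"
    unfolding radial_op_def y_def[symmetric] q_def[symmetric] by (simp add: N1)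
  also have "\<dots> = m * w * (b2 + ((m + 1) * q * (1 - y) - 2) * b1)"
    using qm by algebra
  finally show ?thesis by (simp add: N1)
qed

lemma DERIV_first_harmonic:
  fixes n :: nat and b b1 :: "real \<Rightarrow> real"
  defines "q \<equiv> dual_exp n"
  assumes b: "\<And>s. (b has_real_derivative b1 s) (at s)"
    and b1: "\<And>s. (b1 has_real_derivative b2 s) (at s)"
  shows "((\<lambda>s. profile n s * exp (- s) * b s) has_real_derivative
      profile n s * exp (- s) * (q * (1 - profile n s) - 1) * b s + profile n s * exp (- s) * b1 s) (at s)"
   "((\<lambda>s. profile n s * exp (- s) * (q * (1 - profile n s) - 1) * b s + profile n s * exp (- s) * b1 s)
      has_real_derivative
      profile n s * exp (- s) * ((q * (1 - profile n s) - 1)\<^sup>2 - q\<^sup>2 * profile n s * (1 - profile n s)) * b s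
      + 2 * (profile n s * exp (- s) * (q * (1 - profile n s) - 1)) * b1 s + profile n s * exp (- s) * b2 s) (at s)"
  unfolding q_def
  by (rule derivative_eq_intros b b1 refl | simp add: algebra_simps power2_eq_square)+

lemma antiderivative_UNIV:
  fixes f :: "real \<Rightarrow> real"
  assumes "continuous_on UNIV f"
  obtains F where "\<And>x. (F has_real_derivative f x) (at x)" "F a = c"
proof -
  have "\<exists>F. \<forall>x::real. - \<infinity> < ereal x \<longrightarrow> ereal x < \<infinity> \<longrightarrow> (F has_vector_derivative f x) (at x)"
    by (rule einterval_antiderivative)
       (use assms in \<open>auto simp: continuous_on_eq_continuous_at\<close>)
  then obtain F where F: "\<And>x. (F has_real_derivative f x) (at x)"
    by (auto simp: has_real_derivative_iff_has_vector_derivative)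
  show ?thesis
    by (rule that[of "\<lambda>x. F x - F a + c"]) (auto intro!: derivative_eq_intros F)
qed

text \<open>
  The strictly superharmonic part of the barrier. Put \<open>h = w b\<close> with \<open>w = y / r\<close>. By
  \<open>radial_op_first_harmonic\<close> the operator on \<open>h\<close> is, up to a positive factor, the derivative
  of \<open>E = y ^ n b' / r\<^sup>2\<close>. So \<open>E\<close> is chosen positive and decreasing at the required speed,
  and \<open>b\<close> is found by integration. As \<open>E\<close> stays above 1, \<open>b\<close> grows at least like \<open>r\<^sup>2\<close> and
  \<open>h\<close> at least like \<open>r\<close>, faster than any linear function of \<open>s\<close>.
\<close>

lemma radial_barrier_exists:
  fixes n :: nat and s0 :: real
  assumes n: "n \<ge> 2"
  defines "mu \<equiv> real n ^ 3"
  obtains h h1 h2 :: "real \<Rightarrow> real" where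
    "\<And>s. (h has_real_derivative h1 s) (at s)"
    "\<And>s. (h1 has_real_derivative h2 s) (at s)"
    "\<And>s. s \<ge> s0 \<Longrightarrow> mu * (s - s0 + 1) \<le> h s"
    "\<And>s. s \<ge> s0 \<Longrightarrow> radial_op n (real n - 1) s (h s) (h1 s) (h2 s) \<le> - (2 * real n * mu * (s - s0 + 1))"
proof -
  define K where "K = 2 * real n * mu"
  define y where "y = profile n"
  define q where "q = dual_exp n"
  define g where "g s = s - s0 + 1" for s :: real
  \<comment> \<open>The derivative of \<open>E\<close> is exactly \<open>- K g exp (- s)\<close>, the decay that the last claim asks for.\<close>
  define E where "E s = 1 + K * (g s + 1) * exp (- s)" for s
  define b1 where "b1 s = exp (2 * s) * E s / y s ^ n" for s
  define b2 where "b2 s = exp (2 * s) * (- K * g s * exp (- s)) / y s ^ n - (real n * q * (1 - y s) - 2) * b1 s" for s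
  have mu: "mu \<ge> 1" using n by (simp add: mu_def)
  have K: "K \<ge> mu" "K > 0" using n mu by (simp_all add: K_def)
  have yb: "0 < y s" "y s < 1" for s by (simp_all add: y_def profile_bounds)
  have dy: "(y has_real_derivative q * y s * (1 - y s)) (at s)" for s
    unfolding y_def q_def by (auto intro!: derivative_eq_intros)
  have dE: "(E has_real_derivative - K * g s * exp (- s)) (at s)" for s
    unfolding E_def g_def by (auto intro!: derivative_eq_intros simp: algebra_simps)
  have db1: "(b1 has_real_derivative b2 s) (at s)" for s
  proof -
    obtain m where m: "n = Suc m" using n by (metis Suc_le_D numeral_2_eq_2)
    have dyn: "((\<lambda>s. y s ^ n) has_real_derivative real n * q * (1 - y s) * y s ^ n) (at s)"
      using DERIV_power[OF dy, of n] by (simp add: m mult_ac)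
    have de: "((\<lambda>s. exp (2 * s) * E s) has_real_derivative 
      exp (2 * s) * (- K * g s * exp (- s)) + 2 * exp (2 * s) * E s) (at s)"
      by (auto intro!: derivative_eq_intros dE)
    show ?thesis
      unfolding b1_def[abs_def]
      by (rule DERIV_cong[OF DERIV_divide[OF de dyn]])
         (use yb[of s] in \<open>simp_all add: b2_def b1_def field_simps\<close>)
  qed
  have "continuous_on UNIV b1"
    using db1 by (meson DERIV_continuous_on has_field_derivative_at_within)
  then obtain b where b: "\<And>s. (b has_real_derivative b1 s) (at s)"
    and b0: "b s0 = mu * exp s0 / y s0" by (rule antiderivative_UNIV[where a = s0 and c = "mu * exp s0 / y s0"]) (use that in blast)
  note d = DERIV_first_harmonic[where n = n, OF b db1, folded y_def q_def]
  \<comment> \<open>Equality holds at \<open>s0\<close> by the choice of the constant of integration; the derivatives are compared.\<close>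
  have lower: "mu * g s * exp s / y s \<le> b s" if s: "s \<ge> s0" for s
  proof -
    define c where "c t = b t - mu * g t * exp t / y t" for t
    have "c s0 \<le> c s"
    proof (rule DERIV_nonneg_imp_nondecreasing[OF s])
      fix t assume t: "s0 \<le> t" "t \<le> s"
      have gt: "g t \<ge> 1" using t by (simp add: g_def)
      have dc: "(c has_real_derivative b1 t - mu * (1 + g t - q * (1 - y t) * g t) * exp t / y t) (at t)"
        unfolding c_def[abs_def] g_def using yb[of t]
        by (auto intro!: derivative_eq_intros b dy simp: field_simps power2_eq_square)
      have "q * (1 - y t) * g t \<ge> 0"
        using dual_exp_gt_1[OF n] yb[of t] gt by (simp add: q_def)
      then have "mu * (1 + g t - q * (1 - y t) * g t) \<le> mu * (g t + 1)"
        using mu by (intro mult_left_mono) auto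
      also have "\<dots> \<le> K * (g t + 1)"
        by (rule mult_right_mono[OF K(1)]) (use gt in auto)
      finally have "mu * (1 + g t - q * (1 - y t) * g t) \<le> K * (g t + 1)" .
      then have "mu * (1 + g t - q * (1 - y t) * g t) * exp t / y t \<le> K * (g t + 1) * exp t / y t"
        using yb[of t] by (simp add: divide_right_mono mult_right_mono)
      also have "\<dots> \<le> exp (2 * t) * E t / y t"
      proof (rule divide_right_mono)
        have "exp (2 * t) * E t = exp (2 * t) + K * (g t + 1) * (exp (2 * t) * exp (- t))"
          by (simp add: E_def algebra_simps)
        also have "exp (2 * t) * exp (- t) = exp t" by (simp flip: exp_add)
        finally show "K * (g t + 1) * exp t \<le> exp (2 * t) * E t" by simp
      qed (use yb[of t] in auto)
      also have "\<dots> \<le> b1 t"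
        unfolding b1_def
      proof (rule divide_left_mono)
        show "y t ^ n \<le> y t" using power_decreasing[of 1 n "y t"] yb[of t] n by simp
        show "0 \<le> exp (2 * t) * E t" using K gt by (simp add: E_def)
      qed (use yb[of t] in auto)
      finally show "\<exists>y. (c has_real_derivative y) (at t) \<and> 0 \<le> y"
        using dc by (intro exI conjI) auto
    qed
    moreover have "c s0 = 0" by (simp add: c_def b0 g_def)
    ultimately show ?thesis by (simp add: c_def)
  qed
  show ?thesis
  proof (rule that[OF d])
    fix s assume s: "s \<ge> s0"
    have e: "exp (- s) * exp s = 1" by (simp flip: exp_add)
    have w: "y s * exp (- s) > 0" using yb[of s] by simp
    have "mu * g s = y s * exp (- s) * (mu * g s * exp s / y s)"
      using yb[of s] e by (simp add: field_simps)
    also have "\<dots> \<le> y s * exp (- s) * b s"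
      by (rule mult_left_mono[OF lower[OF s]]) (use w in simp)
    finally show "mu * (s - s0 + 1) \<le> y s * exp (- s) * b s" by (simp add: g_def)
    have gs: "g s \<ge> 1" using s by (simp add: g_def)
    have "radial_op n (real n - 1) s (y s * exp (- s) * b s)
          (y s * exp (- s) * (q * (1 - y s) - 1) * b s + y s * exp (- s) * b1 s)
          (y s * exp (- s) * ((q * (1 - y s) - 1)\<^sup>2 - q\<^sup>2 * y s * (1 - y s)) * b s +
           2 * (y s * exp (- s) * (q * (1 - y s) - 1)) * b1 s + y s * exp (- s) * b2 s)
       = (real n - 1) * (y s * exp (- s)) * (b2 s + (real n * q * (1 - y s) - 2) * b1 s)"
      unfolding y_def q_def by (rule radial_op_first_harmonic[OF n])
    also have "\<dots> = - ((real n - 1) * (K * g s) * (exp (- s) * exp (- s) * exp (2 * s)) * (y s / y s ^ n))"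
      by (simp add: b2_def)
    also have "exp (- s) * exp (- s) * exp (2 * s) = 1" by (simp flip: exp_add)
    also have "- ((real n - 1) * (K * g s) * 1 * (y s / y s ^ n)) \<le> - (K * g s)"
    proof -
      have "y s ^ n \<le> y s" using power_decreasing[of 1 n "y s"] yb[of s] n by simp
      then have "1 \<le> y s / y s ^ n" using yb[of s] by simp
      moreover have "1 * (K * g s) \<le> (real n - 1) * (K * g s)"
        by (rule mult_right_mono) (use n K gs in auto)
      ultimately have "K * g s * 1 \<le> (real n - 1) * (K * g s) * (y s / y s ^ n)"
        by (intro mult_mono[of "K * g s"]) (use n K gs in simp_all)
      then show ?thesis by simp
    qed
    finally show "radial_op n (real n - 1) s (y s * exp (- s) * b s)
          (y s * exp (- s) * (q * (1 - y s) - 1) * b s + y s * exp (- s) * b1 s)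
          (y s * exp (- s) * ((q * (1 - y s) - 1)\<^sup>2 - q\<^sup>2 * y s * (1 - y s)) * b s +
           2 * (y s * exp (- s) * (q * (1 - y s) - 1)) * b1 s + y s * exp (- s) * b2 s)
       \<le> - (2 * real n * mu * (s - s0 + 1))"
      by (simp add: K_def g_def)
  qed
qed

section \<open>Calculus of the operator, its maximum principle and reflections\<close>

text \<open>
  The jet is existentially quantified, so that the rules below relate functions to their
  images under the operator with no mention of gradients and Hessians. By uniqueness of jets
  the image is determined on \<open>S\<close>.
\<close>

definition has_liouville :: "(real^'n::finite \<Rightarrow> real) \<Rightarrow> (real^'n \<Rightarrow> real) \<Rightarrow> (real^'n) set \<Rightarrow> bool" where
  "has_liouville f k S \<longleftrightarrow>
     (\<exists>g H. has_jet f g H S \<and> (\<forall>x\<in>S. liouville_op x (f x) (g x) (H x) = k x))"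

lemma has_liouville_subset: "has_liouville f k S \<Longrightarrow> open T \<Longrightarrow> T \<subseteq> S \<Longrightarrow> has_liouville f k T"
  unfolding has_liouville_def by (meson has_jet_subset subsetD)

lemma has_liouville_cong:
  assumes "has_liouville f k S" "\<And>x. x \<in> S \<Longrightarrow> f x = f' x" "\<And>x. x \<in> S \<Longrightarrow> k x = k' x"
  shows "has_liouville f' k' S"
proof -
  obtain g H where "has_jet f g H S" "\<forall>x\<in>S. liouville_op x (f x) (g x) (H x) = k x"
    using assms(1) unfolding has_liouville_def by blast
  with assms(2,3) show ?thesis
    unfolding has_liouville_def by (metis has_jet_cong)
qed

lemma liouville_op_add:
  "liouville_op x (c + c') (g + g') (\<lambda>v. T v + T' v) = liouville_op x c g T + liouville_op x c' g' T'"
  by (simp add: liouville_op_def lin_trace_simps inner_add_right algebra_simps)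

lemma liouville_op_scale:
  "liouville_op x (a * c) (a *\<^sub>R g) (\<lambda>v. a *\<^sub>R T v) = a * liouville_op x c g T"
  by (simp add: liouville_op_def lin_trace_simps algebra_simps)

lemma has_liouville_add:
  assumes "has_liouville f k S" "has_liouville f' k' S"
  shows "has_liouville (\<lambda>x. f x + f' x) (\<lambda>x. k x + k' x) S"
proof -
  obtain g H where 1: "has_jet f g H S" "\<forall>x\<in>S. liouville_op x (f x) (g x) (H x) = k x"
    using assms(1) unfolding has_liouville_def by blast
  obtain g' H' where 2: "has_jet f' g' H' S" "\<forall>x\<in>S. liouville_op x (f' x) (g' x) (H' x) = k' x"
    using assms(2) unfolding has_liouville_def by blast
  have "\<forall>x\<in>S. liouville_op x (f x + f' x) (g x + g' x) (\<lambda>v. H x v + H' x v) = k x + k' x"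
    using 1(2) 2(2) by (simp add: liouville_op_add)
  then show ?thesis
    using has_jet_add[OF 1(1) 2(1)] unfolding has_liouville_def
    by (intro exI[of _ "\<lambda>x. g x + g' x"] exI[of _ "\<lambda>x v. H x v + H' x v"] conjI)
qed

lemma has_liouville_scale:
  assumes "has_liouville f k S"
  shows "has_liouville (\<lambda>x. c * f x) (\<lambda>x. c * k x) S"
proof -
  obtain g H where 1: "has_jet f g H S" "\<forall>x\<in>S. liouville_op x (f x) (g x) (H x) = k x"
    using assms(1) unfolding has_liouville_def by blast
  have "\<forall>x\<in>S. liouville_op x (c * f x) (c *\<^sub>R g x) (\<lambda>v. c *\<^sub>R H x v) = c * k x"
    using 1(2) by (simp add: liouville_op_scale)
  then show ?thesis
    using has_jet_scale[OF 1(1)] unfolding has_liouville_def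
    by (intro exI[of _ "\<lambda>x. c *\<^sub>R g x"] exI[of _ "\<lambda>x v. c *\<^sub>R H x v"] conjI)
qed

lemma has_liouville_diff:
  assumes "has_liouville f k S" "has_liouville f' k' S"
  shows "has_liouville (\<lambda>x. f x - f' x) (\<lambda>x. k x - k' x) S"
  using has_liouville_add[OF assms(1) has_liouville_scale[OF assms(2), of "-1"]] by simp

text \<open>
  The cross terms of the product rule combine: the gradient of a radial function is parallel
  to \<open>x\<close>, so the Laplacian and the second radial derivative contribute the same multiple of
  \<open>x \<bullet> g x\<close>.
\<close>

lemma has_liouville_radial_mult:
  fixes F F1 F2 :: "real \<Rightarrow> real" and p :: "real^'n::finite \<Rightarrow> real"
  assumes F: "\<And>s. (F has_real_derivative F1 s) (at s)" "\<And>s. (F1 has_real_derivative F2 s) (at s)"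
    and p: "has_jet p g H (-{0})"
  shows "has_liouville (\<lambda>x. F (ln (norm x)) * p x)
     (\<lambda>x. F (ln (norm x)) * liouville_op x 0 (g x) (H x)
        + p x * radial_op CARD('n) 0 (ln (norm x)) (F (ln (norm x))) (F1 (ln (norm x))) (F2 (ln (norm x)))
        + 2 * (real CARD('n) - 1) * F1 (ln (norm x)) * (x \<bullet> g x)) (-{0})"
proof -
  note J = has_jet_mult[OF has_jet_radial[where 'n = 'n, OF F] p]
  have "liouville_op x (F (ln (norm x)) * p x)
          (F (ln (norm x)) *\<^sub>R g x + p x *\<^sub>R (F1 (ln (norm x)) / (norm x)\<^sup>2) *\<^sub>R x)
          (\<lambda>v. F (ln (norm x)) *\<^sub>R H x v + ((F1 (ln (norm x)) / (norm x)\<^sup>2) *\<^sub>R x \<bullet> v) *\<^sub>R g x +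
               p x *\<^sub>R
               ((F1 (ln (norm x)) / (norm x)\<^sup>2) *\<^sub>R v +
                ((F2 (ln (norm x)) - 2 * F1 (ln (norm x))) / norm x ^ 4 * (x \<bullet> v)) *\<^sub>R x) +
               (g x \<bullet> v) *\<^sub>R (F1 (ln (norm x)) / (norm x)\<^sup>2) *\<^sub>R x)
     = F (ln (norm x)) * liouville_op x 0 (g x) (H x)
        + p x * radial_op CARD('n) 0 (ln (norm x)) (F (ln (norm x))) (F1 (ln (norm x))) (F2 (ln (norm x)))
        + 2 * (real CARD('n) - 1) * F1 (ln (norm x)) * (x \<bullet> g x)" if "x \<in> -{0}" for x
  proof -
    have r: "norm x > 0" using that by simp
    define f f1 f2 where "f = F (ln (norm x))" and "f1 = F1 (ln (norm x))" and "f2 = F2 (ln (norm x))"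
    define c d where "c = f1 / (norm x)\<^sup>2" and "d = (f2 - 2 * f1) / norm x ^ 4"
    define R where "R = (norm x)\<^sup>2"
    define z where "z = 1 - profile CARD('n) (ln (norm x))"
    have xx: "x \<bullet> x = R" by (simp add: R_def power2_norm_eq_inner)
    have cR: "c * R = f1" and dR: "d * (R * R) = f2 - 2 * f1"
      using r by (simp_all add: c_def d_def R_def power4_eq_xxxx power2_eq_square)
    have f2: "f2 = d * (R * R) + 2 * (c * R)" using cR dR by simp
    let ?T = "\<lambda>v. f *\<^sub>R H x v + (c *\<^sub>R x \<bullet> v) *\<^sub>R g x + p x *\<^sub>R (c *\<^sub>R v + (d * (x \<bullet> v)) *\<^sub>R x) + (g x \<bullet> v) *\<^sub>R c *\<^sub>R x"
    have tr: "lin_trace ?T = f * lin_trace (H x) + c * (x \<bullet> g x) + p x * (c * real CARD('n) + d * R) + c * (x \<bullet> g x)"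
    proof -
      have 1: "lin_trace (\<lambda>v. (d * (x \<bullet> v)) *\<^sub>R x) = d * R"
        using lin_trace_simps(3)[of d "\<lambda>v. (x \<bullet> v) *\<^sub>R x"] by (simp add: lin_trace_rank_one xx)
      show ?thesis
        unfolding lin_trace_simps 1 lin_trace_rank_one lin_trace_id by (simp add: inner_commute[of "g x" x])
    qed
    have xT: "x \<bullet> ?T x = f * (x \<bullet> H x x) + c * R * (x \<bullet> g x) + p x * (c * R + d * (R * R)) + c * R * (x \<bullet> g x)"
      by (simp add: inner_add_right xx inner_commute[of "g x" x] algebra_simps)
    have xg: "x \<bullet> (f *\<^sub>R g x + p x *\<^sub>R c *\<^sub>R x) = f * (x \<bullet> g x) + p x * (c * R)"
      by (simp add: inner_add_right xx)
    show ?thesis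
      unfolding f_def[symmetric] f1_def[symmetric] f2_def[symmetric]
      unfolding c_def[symmetric] d_def[symmetric]
      unfolding liouville_op_def radial_op_def tr xT xg z_def[symmetric] R_def[symmetric]
      unfolding f2 cR[symmetric] by (simp add: algebra_simps)
  qed
  note key = this
  show ?thesis
    unfolding has_liouville_def
    by (rule exI, rule exI, rule conjI[OF J], rule ballI, rule key)
qed

lemma has_liouville_radial:
  fixes F F1 F2 :: "real \<Rightarrow> real"
  assumes F: "\<And>s. (F has_real_derivative F1 s) (at s)" "\<And>s. (F1 has_real_derivative F2 s) (at s)"
  shows "has_liouville (\<lambda>x::real^'n::finite. F (ln (norm x)))
     (\<lambda>x. radial_op CARD('n) 0 (ln (norm x)) (F (ln (norm x))) (F1 (ln (norm x))) (F2 (ln (norm x)))) (-{0})"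
  by (rule has_liouville_cong[OF has_liouville_radial_mult[where 'n='n, OF F has_jet_const[of "-{0}" 1]]])
     (auto simp: open_Compl liouville_op_def lin_trace_simps(4))

lemma has_liouville_first_harmonic:
  fixes F F1 F2 :: "real \<Rightarrow> real" and e :: "real^'n::finite"
  assumes F: "\<And>s. (F has_real_derivative F1 s) (at s)" "\<And>s. (F1 has_real_derivative F2 s) (at s)"
  shows "has_liouville (\<lambda>x. F (ln (norm x)) * ((x \<bullet> e) / norm x))
     (\<lambda>x. (x \<bullet> e) / norm x *
        radial_op CARD('n) (real CARD('n) - 1) (ln (norm x)) (F (ln (norm x))) (F1 (ln (norm x))) (F2 (ln (norm x)))) (-{0})"
proof -
  have 1: "((\<lambda>s. F s * exp (- s)) has_real_derivative (F1 s - F s) * exp (- s)) (at s)" for s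
    by (auto intro!: derivative_eq_intros F simp: algebra_simps)
  have 2: "((\<lambda>s. (F1 s - F s) * exp (- s)) has_real_derivative (F2 s - 2 * F1 s + F s) * exp (- s)) (at s)" for s
    by (auto intro!: derivative_eq_intros F simp: algebra_simps)
  have j: "has_jet (\<lambda>x::real^'n. x \<bullet> e) (\<lambda>x. e) (\<lambda>x v. 0) (-{0})"
    by (rule has_jet_inner) (simp add: open_Compl)
  show ?thesis
  proof (rule has_liouville_cong[OF has_liouville_radial_mult[OF 1 2 j]])
    fix x :: "real^'n" assume "x \<in> -{0}"
    then have r: "norm x > 0" by simp
    then have ex: "exp (- ln (norm x)) = 1 / norm x" by (simp add: exp_minus inverse_eq_divide)
    show "F (ln (norm x)) * exp (- ln (norm x)) * (x \<bullet> e) = F (ln (norm x)) * ((x \<bullet> e) / norm x)"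
      by (simp add: ex)
    show "F (ln (norm x)) * exp (- ln (norm x)) * liouville_op x 0 e (\<lambda>v. 0) +
         (x \<bullet> e) * radial_op CARD('n) 0 (ln (norm x)) (F (ln (norm x)) * exp (- ln (norm x)))
          ((F1 (ln (norm x)) - F (ln (norm x))) * exp (- ln (norm x)))
          ((F2 (ln (norm x)) - 2 * F1 (ln (norm x)) + F (ln (norm x))) * exp (- ln (norm x))) +
         2 * (real CARD('n) - 1) * ((F1 (ln (norm x)) - F (ln (norm x))) * exp (- ln (norm x))) * (x \<bullet> e)
       = (x \<bullet> e) / norm x *
        radial_op CARD('n) (real CARD('n) - 1) (ln (norm x)) (F (ln (norm x))) (F1 (ln (norm x))) (F2 (ln (norm x)))"
      unfolding ex liouville_op_def radial_op_def lin_trace_simps(4) divide_inverse by (simp add: algebra_simps)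
  qed
qed

text \<open>
  The square of \<open>t = (x \<bullet> e) / r\<close> is a spherical harmonic for the eigenvalue \<open>2 N\<close> up to an
  additive constant, which produces the extra term \<open>2 F\<close>.
\<close>

lemma has_liouville_second_harmonic:
  fixes F F1 F2 :: "real \<Rightarrow> real" and e :: "real^'n::finite"
  assumes F: "\<And>s. (F has_real_derivative F1 s) (at s)" "\<And>s. (F1 has_real_derivative F2 s) (at s)"
    and e: "norm e = 1"
  shows "has_liouville (\<lambda>x. F (ln (norm x)) * ((x \<bullet> e) / norm x)\<^sup>2)
     (\<lambda>x. ((x \<bullet> e) / norm x)\<^sup>2 *
        radial_op CARD('n) (2 * real CARD('n)) (ln (norm x)) (F (ln (norm x))) (F1 (ln (norm x))) (F2 (ln (norm x)))
        + 2 * F (ln (norm x))) (-{0})"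
proof -
  have 1: "((\<lambda>s. F s * exp (- 2 * s)) has_real_derivative (F1 s - 2 * F s) * exp (- 2 * s)) (at s)" for s
    by (auto intro!: derivative_eq_intros F simp: algebra_simps)
  have 2: "((\<lambda>s. (F1 s - 2 * F s) * exp (- 2 * s)) has_real_derivative (F2 s - 4 * F1 s + 4 * F s) * exp (- 2 * s)) (at s)" for s
    by (auto intro!: derivative_eq_intros F simp: algebra_simps)
  have j0: "has_jet (\<lambda>x::real^'n. x \<bullet> e) (\<lambda>x. e) (\<lambda>x v. 0) (-{0})"
    by (rule has_jet_inner) (simp add: open_Compl)
  note j = has_jet_mult[OF j0 j0]
  have ee: "e \<bullet> e = 1" using e by (simp add: norm_eq_1)
  show ?thesis
  proof (rule has_liouville_cong[OF has_liouville_radial_mult[OF 1 2 j]])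
    fix x :: "real^'n" assume "x \<in> -{0}"
    then have r: "norm x > 0" by simp
    have "exp (- 2 * ln (norm x)) = inverse (exp (ln (norm x)) * exp (ln (norm x)))"
      by (simp flip: exp_add exp_minus)
    then have ex: "exp (- 2 * ln (norm x)) = 1 / (norm x)\<^sup>2"
      using r by (simp add: inverse_eq_divide power2_eq_square)
    show "F (ln (norm x)) * exp (- 2 * ln (norm x)) * ((x \<bullet> e) * (x \<bullet> e)) = F (ln (norm x)) * ((x \<bullet> e) / norm x)\<^sup>2"
      unfolding ex by (simp add: power2_eq_square)
    show "F (ln (norm x)) * exp (- 2 * ln (norm x)) *
         liouville_op x 0 ((x \<bullet> e) *\<^sub>R e + (x \<bullet> e) *\<^sub>R e)
          (\<lambda>v. (x \<bullet> e) *\<^sub>R 0 + (e \<bullet> v) *\<^sub>R e + (x \<bullet> e) *\<^sub>R 0 + (e \<bullet> v) *\<^sub>R e) +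
         (x \<bullet> e) * (x \<bullet> e) *
         radial_op CARD('n) 0 (ln (norm x)) (F (ln (norm x)) * exp (- 2 * ln (norm x)))
          ((F1 (ln (norm x)) - 2 * F (ln (norm x))) * exp (- 2 * ln (norm x)))
          ((F2 (ln (norm x)) - 4 * F1 (ln (norm x)) + 4 * F (ln (norm x))) * exp (- 2 * ln (norm x))) +
         2 * (real CARD('n) - 1) * ((F1 (ln (norm x)) - 2 * F (ln (norm x))) * exp (- 2 * ln (norm x))) *
         (x \<bullet> ((x \<bullet> e) *\<^sub>R e + (x \<bullet> e) *\<^sub>R e))
       = ((x \<bullet> e) / norm x)\<^sup>2 *
        radial_op CARD('n) (2 * real CARD('n)) (ln (norm x)) (F (ln (norm x))) (F1 (ln (norm x))) (F2 (ln (norm x)))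
        + 2 * F (ln (norm x))"
    proof -
      define l where "l = x \<bullet> e"
      define z where "z = 1 - profile CARD('n) (ln (norm x))"
      have tr: "lin_trace (\<lambda>v. (x \<bullet> e) *\<^sub>R 0 + (e \<bullet> v) *\<^sub>R e + (x \<bullet> e) *\<^sub>R 0 + (e \<bullet> v) *\<^sub>R e) = 2"
        unfolding lin_trace_simps lin_trace_rank_one by (simp add: ee lin_trace_simps(4))
      have xg: "x \<bullet> ((x \<bullet> e) *\<^sub>R e + (x \<bullet> e) *\<^sub>R e) = 2 * (l * l)"
        unfolding inner_add_right inner_scaleR_right l_def by simp
      have xT: "x \<bullet> ((x \<bullet> e) *\<^sub>R 0 + (e \<bullet> x) *\<^sub>R e + (x \<bullet> e) *\<^sub>R 0 + (e \<bullet> x) *\<^sub>R e) = 2 * (l * l)"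
        unfolding inner_add_right inner_scaleR_right l_def inner_commute[of e x] by simp
      define R k where "R = (norm x)\<^sup>2" and "k = 1 / R"
      have kR: "k * R = 1" using r by (simp add: k_def R_def)
      have t2: "(l / norm x)\<^sup>2 = l * l * k" by (simp add: power2_eq_square k_def R_def)
      show ?thesis
        unfolding ex liouville_op_def radial_op_def tr xg xT
        unfolding l_def[symmetric] z_def[symmetric]
          R_def[symmetric] k_def[symmetric] t2
        using kR by algebra
    qed
  qed
qed

text \<open>
  Pointwise weak maximum principle: at a zero maximum the zeroth and first order terms
  vanish and the second order part is nonpositive. This holds whatever the sign of the
  potential.
\<close>

lemma has_liouville_max:
  fixes x :: "real^'n::finite"
  assumes N: "CARD('n) \<ge> 2" and f: "has_liouville f k S" and x: "x \<in> S" "f x = 0"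
    and le: "\<And>y. y \<in> S \<Longrightarrow> f y \<le> 0"
  shows "k x \<le> 0"
proof -
  obtain g H where j: "has_jet f g H S" and k: "liouville_op x (f x) (g x) (H x) = k x"
    using f x unfolding has_liouville_def by blast
  have max: "f y \<le> f x" if "y \<in> S" for y using le[OF that] x by simp
  note l = has_jet_local_max[OF j x(1) max]
  have "lin_trace (H x) \<le> 0" using l(2) by (rule lin_trace_nonpos)
  then have "(norm x)\<^sup>2 * lin_trace (H x) \<le> 0" by (simp add: mult_nonneg_nonpos)
  moreover have "(real CARD('n) - 2) * (x \<bullet> H x x) \<le> 0"
    using N l(2) by (simp add: mult_nonneg_nonpos)
  ultimately show ?thesis using k l(1) x(2) by (simp add: liouville_op_def)
qed

definition reflect :: "'a::real_inner \<Rightarrow> 'a \<Rightarrow> 'a" where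
  "reflect e x = x - (2 * (x \<bullet> e)) *\<^sub>R e"

lemma bounded_linear_reflect: "bounded_linear (reflect e)"
  unfolding reflect_def
  by (intro bounded_linear_sub bounded_linear_ident bounded_linear_compose[OF bounded_linear_scaleR_left]
       bounded_linear_const_mult bounded_linear_inner_left)

lemma reflect_reflect: "norm e = 1 \<Longrightarrow> reflect e (reflect e x) = x"
  by (simp add: reflect_def inner_diff_left norm_eq_1 algebra_simps)

lemma reflect_inner: "reflect e x \<bullet> y = x \<bullet> reflect e y"
  by (simp add: reflect_def inner_diff_left inner_diff_right inner_commute)

lemma norm_reflect: "norm e = 1 \<Longrightarrow> norm (reflect e x) = norm x"
  by (simp add: norm_eq_sqrt_inner reflect_inner reflect_reflect)

lemma reflect_inner_axis: "norm e = 1 \<Longrightarrow> reflect e x \<bullet> e = - (x \<bullet> e)"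
  by (simp add: reflect_def inner_diff_left norm_eq_1)

text \<open>
  All ingredients of \<open>liouville_op\<close> are invariant under orthogonal maps.
\<close>

lemma has_liouville_reflect:
  fixes e :: "real^'n::finite"
  assumes e: "norm e = 1" and f: "has_liouville f k (-{0})"
  shows "has_liouville (\<lambda>x. f (reflect e x)) (\<lambda>x. k (reflect e x)) (-{0})"
proof -
  obtain g H where j: "has_jet f g H (-{0})" and k: "\<forall>x\<in>-{0}. liouville_op x (f x) (g x) (H x) = k x"
    using f unfolding has_liouville_def by blast
  have nz: "reflect e x \<in> -{0}" if "x \<in> -{0}" for x
    using that norm_reflect[OF e, of x] by (metis Compl_iff norm_eq_zero singleton_iff)
  note d = bounded_linear_imp_has_derivative[OF bounded_linear_reflect[of e]]
  have "has_jet (\<lambda>x. f (reflect e x)) (\<lambda>x. reflect e (g (reflect e x))) (\<lambda>x v. reflect e (H (reflect e x) (reflect e v))) (-{0})"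
  proof (rule has_jetI)
    fix x :: "real^'n" assume x: "x \<in> -{0}"
    show "((\<lambda>x. f (reflect e x)) has_derivative (\<lambda>v. g (reflect e x) \<bullet> reflect e v)) (at x)"
      by (rule has_derivative_compose[OF d has_jetD(1)[OF j nz[OF x]]])
    have "((\<lambda>x. g (reflect e x)) has_derivative (\<lambda>v. H (reflect e x) (reflect e v))) (at x)"
      by (rule has_derivative_compose[OF d has_jetD(2)[OF j nz[OF x]]])
    then show "((\<lambda>x. reflect e (g (reflect e x))) has_derivative (\<lambda>v. reflect e (H (reflect e x) (reflect e v)))) (at x)"
      by (rule bounded_linear.has_derivative[OF bounded_linear_reflect])
  qed (auto simp: reflect_inner open_Compl)
  moreover have "liouville_op x (f (reflect e x)) (reflect e (g (reflect e x))) (\<lambda>v. reflect e (H (reflect e x) (reflect e v))) = k (reflect e x)"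
    if x: "x \<in> -{0}" for x
  proof -
    have "lin_trace (\<lambda>v. reflect e (H (reflect e x) (reflect e v))) = lin_trace (H (reflect e x))"
      by (rule lin_trace_conj) (use has_jetD(3)[OF j nz[OF x]] bounded_linear_reflect[of e] in
          \<open>auto simp: reflect_reflect e bounded_linear.linear\<close>)
    then have "liouville_op x (f (reflect e x)) (reflect e (g (reflect e x))) (\<lambda>v. reflect e (H (reflect e x) (reflect e v)))
      = liouville_op (reflect e x) (f (reflect e x)) (g (reflect e x)) (H (reflect e x))"
      by (simp add: liouville_op_def norm_reflect[OF e] reflect_inner[symmetric])
    then show ?thesis using k nz[OF x] by simp
  qed
  ultimately show ?thesis unfolding has_liouville_def by blast
qed

section \<open>Comparison on a half space\<close>

lemma has_liouville_continuous:
  assumes "has_liouville f k S" shows "continuous_on S f"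
proof -
  obtain g H where "has_jet f g H S" using assms unfolding has_liouville_def by blast
  then show ?thesis
    by (intro continuous_at_imp_continuous_on ballI has_derivative_continuous) (rule has_jetD(1))
qed

text \<open>
  Up to a constant factor, the derivative of the bubble in the direction \<open>e\<close>: the
  infinitesimal translation mode.
\<close>

definition dipole :: "real^'n::finite \<Rightarrow> real^'n \<Rightarrow> real" where
  "dipole e x = profile CARD('n) (ln (norm x)) / (norm x)\<^sup>2 * (x \<bullet> e)"

lemma dipole_has_liouville:
  fixes e :: "real^'n::finite"
  assumes n: "CARD('n) \<ge> 2"
  shows "has_liouville (dipole e) (\<lambda>x. 0) (-{0})"
proof -
  have b: "((\<lambda>s::real. 1::real) has_real_derivative 0) (at s)"
    "((\<lambda>s::real. 0::real) has_real_derivative 0) (at s)" for s by simp_all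
  show ?thesis
  proof (rule has_liouville_cong[OF has_liouville_first_harmonic[of _ _ _ e, OF DERIV_first_harmonic[of _ _ _ "CARD('n)", OF b]]])
    fix x :: "real^'n" assume x: "x \<in> -{0}"
    then have r: "norm x > 0" by simp
    show "profile CARD('n) (ln (norm x)) * exp (- ln (norm x)) * 1 * (x \<bullet> e / norm x) = dipole e x"
      using r by (simp add: dipole_def exp_minus power2_eq_square field_simps)
  next
    fix x :: "real^'n"
    show "x \<bullet> e / norm x * radial_op CARD('n) (real CARD('n) - 1) (ln (norm x))
          (profile CARD('n) (ln (norm x)) * exp (- ln (norm x)) * 1)
          (profile CARD('n) (ln (norm x)) * exp (- ln (norm x)) * (dual_exp CARD('n) * (1 - profile CARD('n) (ln (norm x))) - 1) * 1 +
           profile CARD('n) (ln (norm x)) * exp (- ln (norm x)) * 0)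
          (profile CARD('n) (ln (norm x)) * exp (- ln (norm x)) *
           ((dual_exp CARD('n) * (1 - profile CARD('n) (ln (norm x))) - 1)\<^sup>2 -
            (dual_exp CARD('n))\<^sup>2 * profile CARD('n) (ln (norm x)) * (1 - profile CARD('n) (ln (norm x)))) * 1 +
           2 * (profile CARD('n) (ln (norm x)) * exp (- ln (norm x)) * (dual_exp CARD('n) * (1 - profile CARD('n) (ln (norm x))) - 1)) * 0 +
           profile CARD('n) (ln (norm x)) * exp (- ln (norm x)) * 0) = 0"
      unfolding radial_op_first_harmonic[OF n] by simp
  qed
qed

text \<open>
  With \<open>t = (x \<bullet> e) / r\<close>, the barrier is \<open>G = h t + c (1 - \<mu> t\<^sup>2)\<close>, where
  \<open>c = 1 + ln (r / rho)\<close> and \<open>\<mu> = N\<^sup>3\<close>. On the boundary hyperplane \<open>t = 0\<close> the function \<open>c\<close>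
  alone is not a supersolution, since the potential is positive; the term \<open>- \<mu> t\<^sup>2\<close>, whose
  spherical Laplacian is \<open>- 2 \<mu>\<close> at \<open>t = 0\<close>, corrects this. Away from the hyperplane that
  term works against both positivity and the sign of the operator, and \<open>h t\<close> from
  \<open>radial_barrier_exists\<close> compensates it because \<open>t\<^sup>2 \<le> t\<close>. A positive supersolution on the
  closed half space cannot be a product of radial and angular factors with the profile of
  the dipole: the hemisphere has first eigenvalue exactly \<open>N - 1\<close>.
\<close>

lemma halfspace_barrier:
  fixes e :: "real^'n::finite" and rho :: real
  assumes n: "CARD('n) \<ge> 2" and e: "norm e = 1" and rho: "rho > 0"
  obtains G k :: "real^'n \<Rightarrow> real" where "has_liouville G k (-{0})"
    "\<And>x. norm x \<ge> rho \<Longrightarrow> x \<bullet> e \<ge> 0 \<Longrightarrow> G x \<ge> 1 + ln (norm x / rho)"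
    "\<And>x. norm x \<ge> rho \<Longrightarrow> x \<bullet> e \<ge> 0 \<Longrightarrow> k x < 0"
proof -
  let ?n = "CARD('n)" and ?N = "real CARD('n)"
  define mu where "mu = ?N ^ 3"
  define s0 where "s0 = ln rho"
  define c where "c s = s - s0 + 1" for s
  obtain h h1 h2 where h: "\<And>s. (h has_real_derivative h1 s) (at s)"
      "\<And>s. (h1 has_real_derivative h2 s) (at s)"
    and h_ge: "\<And>s. s \<ge> s0 \<Longrightarrow> mu * c s \<le> h s"
    and h_op: "\<And>s. s \<ge> s0 \<Longrightarrow> radial_op ?n (?N - 1) s (h s) (h1 s) (h2 s) \<le> - (2 * ?N * mu * c s)"
    using radial_barrier_exists[OF n, of s0] unfolding mu_def c_def by metis
  have c: "(c has_real_derivative 1) (at s)" "((\<lambda>s. 1) has_real_derivative 0) (at s)" for s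
    unfolding c_def by (auto intro!: derivative_eq_intros)
  define t where "t x = (x \<bullet> e) / norm x" for x
  define G where "G x = h (ln (norm x)) * t x + c (ln (norm x)) - mu * (c (ln (norm x)) * (t x)\<^sup>2)" for x
  define k where "k x = t x * radial_op ?n (?N - 1) (ln (norm x)) (h (ln (norm x))) (h1 (ln (norm x))) (h2 (ln (norm x)))
      + radial_op ?n 0 (ln (norm x)) (c (ln (norm x))) 1 0
      - mu * ((t x)\<^sup>2 * radial_op ?n (2 * ?N) (ln (norm x)) (c (ln (norm x))) 1 0 + 2 * c (ln (norm x)))" for x
  have "has_liouville G k (-{0})"
    unfolding G_def[abs_def] k_def[abs_def] t_def
    by (intro has_liouville_diff has_liouville_add has_liouville_scale has_liouville_first_harmonic[OF h]
       has_liouville_radial[OF c] has_liouville_second_harmonic[OF c e])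
  moreover have "G x \<ge> 1 + ln (norm x / rho) \<and> k x < 0" if r: "norm x \<ge> rho" and xe: "x \<bullet> e \<ge> 0" for x
  proof -
    define s where "s = ln (norm x)"
    have r0: "norm x > 0" using r rho by linarith
    have s: "s \<ge> s0" using r rho r0 by (simp add: s_def s0_def)
    have cs: "c s \<ge> 1" using s by (simp add: c_def)
    have t: "0 \<le> t x" "t x \<le> 1"
      using xe r0 Cauchy_Schwarz_ineq2[of x e] e by (auto simp: t_def)
    have tt: "(t x)\<^sup>2 \<le> t x" using t by (simp add: power2_eq_square mult_left_le)
    have N: "?N \<ge> 2" using n by simp
    have mu: "mu > 0" using N by (simp add: mu_def)
    have "mu * (c s * (t x)\<^sup>2) \<le> mu * (c s * t x)"
      using mu cs tt by (intro mult_left_mono) auto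
    also have "\<dots> \<le> h s * t x"
      using mult_right_mono[OF h_ge[OF s] t(1)] by (simp add: mult_ac)
    finally have G: "G x \<ge> c s" by (simp add: G_def s_def)
    have "c s = 1 + ln (norm x / rho)" using r0 rho by (simp add: c_def s_def s0_def ln_div)
    with G have 1: "G x \<ge> 1 + ln (norm x / rho)" by simp
    define y where "y = profile ?n s"
    have y: "0 < y" "y < 1" by (simp_all add: y_def profile_bounds)
    define V where "V = ?N\<^sup>2 * dual_exp ?n * y * (1 - y)"
    define B where "B = ?N * (?N - 2) * (1 - y)"
    have q: "1 < dual_exp ?n" "dual_exp ?n \<le> 2"
      using N dual_exp_gt_1[OF n] by (simp_all add: dual_exp_def field_simps)
    have y4: "y * (1 - y) \<le> 1 / 4"
      using sum_squares_ge_zero[of "y - 1/2" 0] by (simp add: algebra_simps)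
    have V: "0 \<le> V" "V \<le> ?N\<^sup>2"
    proof -
      show "0 \<le> V" using y q by (simp add: V_def)
      have "dual_exp ?n * (y * (1 - y)) \<le> 2 * (1 / 4)"
        by (intro mult_mono) (use q y y4 in auto)
      then have "?N\<^sup>2 * (dual_exp ?n * (y * (1 - y))) \<le> ?N\<^sup>2 * 1"
        by (intro mult_left_mono) auto
      then show "V \<le> ?N\<^sup>2" by (simp add: V_def mult_ac)
    qed
    have B: "0 \<le> B" "B \<le> ?N\<^sup>2"
    proof -
      show "0 \<le> B" using y N by (simp add: B_def)
      have "?N * (?N - 2) * (1 - y) \<le> ?N * ?N * 1"
        by (intro mult_mono) (use y N in auto)
      then show "B \<le> ?N\<^sup>2" by (simp add: B_def power2_eq_square)
    qed
    have "k x = t x * radial_op ?n (?N - 1) s (h s) (h1 s) (h2 s) + (B + V * c s)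
      - mu * ((t x)\<^sup>2 * (B + (V - 2 * ?N) * c s) + 2 * c s)"
      by (simp add: k_def radial_op_def B_def V_def s_def y_def)
    also have "\<dots> \<le> t x * (- (2 * ?N * mu * c s)) + (B + V * c s)
      - mu * ((t x)\<^sup>2 * (B + (V - 2 * ?N) * c s) + 2 * c s)"
      using mult_left_mono[OF h_op[OF s] t(1)] by simp
    also have "\<dots> = 2 * ?N * (mu * (c s * (t x)\<^sup>2) - mu * (c s * t x)) + (B + V * c s - 2 * mu * c s)
      - mu * (t x)\<^sup>2 * (B + V * c s)"
      by (simp add: algebra_simps)
    also have "\<dots> \<le> B + V * c s - 2 * mu * c s"
    proof -
      have "2 * ?N * (mu * (c s * (t x)\<^sup>2) - mu * (c s * t x)) \<le> 0"
        using \<open>mu * (c s * (t x)\<^sup>2) \<le> mu * (c s * t x)\<close> N by (intro mult_nonneg_nonpos) auto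
      moreover have "0 \<le> mu * (t x)\<^sup>2 * (B + V * c s)"
        using mu B V cs by (intro mult_nonneg_nonneg add_nonneg_nonneg) auto
      ultimately show ?thesis by linarith
    qed
    also have "\<dots> < 0"
    proof -
      have "B \<le> ?N\<^sup>2 * c s" using mult_mono[OF B(2) cs] by simp
      moreover have "V * c s \<le> ?N\<^sup>2 * c s" using V cs by (intro mult_right_mono) auto
      moreover have "2 * ?N\<^sup>2 * c s \<le> mu * c s"
        using N cs by (intro mult_right_mono) (auto simp: mu_def power3_eq_cube power2_eq_square)
      moreover have "mu * c s > 0" using mu cs by simp
      ultimately show ?thesis by linarith
    qed
    finally show ?thesis using 1 by blast
  qed
  ultimately show ?thesis using that by blast
qed

text \<open>
  If \<open>f\<close> were positive somewhere, then \<open>f / G\<close>, with the barrier \<open>G\<close>, would attain a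
  positive maximum \<open>m\<close>: its positive part tends to 0 at infinity as \<open>f\<close> is bounded above and
  \<open>G\<close> tends to infinity. The maximum point is interior, and there \<open>f - m G\<close> has a zero maximum but a
  positive image under the operator.
\<close>

lemma halfspace_max_principle:
  fixes e :: "real^'n::finite"
  assumes n: "CARD('n) \<ge> 2" and e: "norm e = 1" and rho: "rho > 0"
    and f: "has_liouville f (\<lambda>x. 0) (-{0})"
    and M: "\<And>x. norm x \<ge> rho \<Longrightarrow> x \<bullet> e \<ge> 0 \<Longrightarrow> f x \<le> M"
    and flat: "\<And>x. x \<bullet> e = 0 \<Longrightarrow> f x \<le> 0"
    and sphere: "\<And>x. norm x = rho \<Longrightarrow> x \<bullet> e \<ge> 0 \<Longrightarrow> f x \<le> 0"
    and x: "norm x \<ge> rho" "x \<bullet> e \<ge> 0"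
  shows "f x \<le> 0"
proof (rule ccontr)
  assume "\<not> f x \<le> 0"
  then have fx: "f x > 0" by simp
  obtain G k where G: "has_liouville G k (-{0})"
    and G_ge: "\<And>x. norm x \<ge> rho \<Longrightarrow> x \<bullet> e \<ge> 0 \<Longrightarrow> G x \<ge> 1 + ln (norm x / rho)"
    and k: "\<And>x. norm x \<ge> rho \<Longrightarrow> x \<bullet> e \<ge> 0 \<Longrightarrow> k x < 0"
    by (rule halfspace_barrier[OF n e rho]) blast
  have G_pos: "G x > 0" if "norm x \<ge> rho" "x \<bullet> e \<ge> 0" for x
  proof -
    have "0 \<le> ln (norm x / rho)" using that(1) rho by simp
    then show ?thesis using G_ge[OF that] by linarith
  qed
  define eta where "eta = f x / G x"
  have eta: "eta > 0" using fx G_pos[OF x] by (simp add: eta_def)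
  have Mpos: "M > 0" using M[OF x] fx by linarith
  \<comment> \<open>Beyond the radius \<open>R\<close> the barrier exceeds \<open>M / eta\<close>, so \<open>f / G\<close> stays below its value at \<open>x\<close>.\<close>
  define R where "R = max (norm x) (rho * exp (M / eta))"
  define K where "K = {x. rho \<le> norm x} \<inter> {x. 0 \<le> x \<bullet> e} \<inter> cball 0 R"
  have "compact K"
    unfolding K_def
    by (intro closed_Int_compact closed_Int compact_cball closed_Collect_le continuous_intros)
  moreover have xK: "x \<in> K" using x by (simp add: K_def R_def)
  moreover have "continuous_on K (\<lambda>x. f x / G x)"
  proof (rule continuous_on_divide)
    have "K \<subseteq> -{0}" using rho by (auto simp: K_def)
    then show "continuous_on K f" "continuous_on K G"
      using has_liouville_continuous f G continuous_on_subset by blast+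
    show "\<forall>x\<in>K. G x \<noteq> 0" using G_pos by (fastforce simp: K_def)
  qed
  ultimately obtain p where p: "p \<in> K" "\<And>y. y \<in> K \<Longrightarrow> f y / G y \<le> f p / G p"
    using continuous_attains_sup[of K] by blast
  define m where "m = f p / G p"
  have m: "m \<ge> eta" using p(2)[OF xK] by (simp add: m_def eta_def)
  have pr: "norm p \<ge> rho" "p \<bullet> e \<ge> 0" using p(1) by (simp_all add: K_def)
  have fp: "f p = m * G p" using G_pos[OF pr] by (simp add: m_def)
  then have fp_pos: "f p > 0" using m eta G_pos[OF pr] by simp
  have le: "f y \<le> m * G y" if y: "norm y \<ge> rho" "y \<bullet> e \<ge> 0" for y
  proof (cases "y \<in> K")
    case True
    then show ?thesis using p(2)[OF True] G_pos[OF y] by (simp add: m_def field_simps)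
  next
    case False
    then have "rho * exp (M / eta) < norm y" using y by (auto simp: K_def R_def)
    then have "exp (M / eta) < norm y / rho" using rho by (simp add: field_simps)
    then have "M / eta < ln (norm y / rho)"
      by (metis exp_gt_zero ln_exp ln_less_cancel_iff order_less_trans)
    then have "M / eta < G y" using G_ge[OF y] by linarith
    then have "M < eta * G y" using eta by (simp add: field_simps)
    also have "\<dots> \<le> m * G y" using m G_pos[OF y] by simp
    finally show ?thesis using M[OF y] by linarith
  qed
  define S where "S = {x. rho < norm x} \<inter> {x. 0 < x \<bullet> e}"
  have S: "open S" unfolding S_def
    by (intro open_Int open_Collect_less continuous_intros)
  have S0: "S \<subseteq> -{0}" using rho by (auto simp: S_def)
  have pS: "p \<in> S"
    using pr sphere[of p] flat[of p] fp_pos by (fastforce simp: S_def)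
  have "has_liouville (\<lambda>x. f x - m * G x) (\<lambda>x. 0 - m * k x) S"
    by (intro has_liouville_subset[OF _ S S0] has_liouville_diff has_liouville_scale f G)
  then have "0 - m * k p \<le> 0"
    by (rule has_liouville_max[OF n _ pS]) (use fp le in \<open>auto simp: S_def\<close>)
  moreover have "m * k p < 0" using k[OF pr] m eta by (simp add: mult_pos_neg)
  ultimately show False by simp
qed

lemma dipole_nonneg: "x \<bullet> e \<ge> 0 \<Longrightarrow> dipole e x \<ge> 0"
  using profile_bounds(1) by (auto simp: dipole_def less_imp_le)

lemma abs_dipole_le:
  fixes e :: "real^'n::finite"
  assumes "norm e = 1" "norm x \<ge> rho" "rho > 0"
  shows "\<bar>dipole e x\<bar> \<le> 1 / rho"
proof -
  have r: "norm x > 0" using assms by linarith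
  have "\<bar>x \<bullet> e\<bar> \<le> norm x" using Cauchy_Schwarz_ineq2[of x e] assms(1) by simp
  have "\<bar>dipole e x\<bar> = profile CARD('n) (ln (norm x)) / (norm x)\<^sup>2 * \<bar>x \<bullet> e\<bar>"
    using profile_bounds(1)[of "CARD('n)" "ln (norm x)"] by (simp add: dipole_def abs_mult)
  also have "\<dots> \<le> 1 / (norm x)\<^sup>2 * norm x"
    using \<open>\<bar>x \<bullet> e\<bar> \<le> norm x\<close> profile_bounds[of "CARD('n)" "ln (norm x)"]
    by (intro mult_mono divide_right_mono) auto
  also have "\<dots> = 1 / norm x" using r by (simp add: power2_eq_square)
  also have "\<dots> \<le> 1 / rho" using assms r by (intro divide_left_mono) auto
  finally show ?thesis .
qed

text \<open>
  The condition at the origin is stated with a margin \<open>d\<close> because a limit of the quotient of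
  \<open>u\<close> and the dipole gives exactly this. On the sphere of radius \<open>rho\<close> it supplies the
  boundary values for the maximum principle outside; at last \<open>d\<close> tends to 0.
\<close>

lemma halfspace_comparison:
  fixes e :: "real^'n::finite"
  assumes n: "CARD('n) \<ge> 2" and e: "norm e = 1"
    and u: "has_liouville u (\<lambda>x. 0) (-{0})"
    and M: "\<And>x. u x \<le> M"
    and flat: "\<And>x. x \<bullet> e = 0 \<Longrightarrow> u x \<le> 0"
    and origin: "\<And>d. d > 0 \<Longrightarrow> \<exists>rho>0. \<forall>x. x \<noteq> 0 \<longrightarrow> norm x \<le> rho \<longrightarrow> x \<bullet> e \<ge> 0 \<longrightarrow> u x \<le> (c + d) * dipole e x"
    and x: "x \<noteq> 0" "x \<bullet> e \<ge> 0"
  shows "u x \<le> c * dipole e x"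
proof -
  have "u x \<le> (c + d) * dipole e x" if d: "d > 0" for d
  proof -
    obtain rho where rho: "rho > 0"
      and near: "\<And>x. x \<noteq> 0 \<Longrightarrow> norm x \<le> rho \<Longrightarrow> x \<bullet> e \<ge> 0 \<Longrightarrow> u x \<le> (c + d) * dipole e x"
      using origin[OF d] by blast
    show ?thesis
    proof (cases "norm x \<le> rho")
      case True
      then show ?thesis using near x by blast
    next
      case False
      have "u x - (c + d) * dipole e x \<le> 0"
      proof (rule halfspace_max_principle[OF n e rho, where f = "\<lambda>x. u x - (c + d) * dipole e x"])
        show "has_liouville (\<lambda>x. u x - (c + d) * dipole e x) (\<lambda>x. 0) (-{0})"
          using has_liouville_diff[OF u has_liouville_scale[OF dipole_has_liouville[OF n, of e], of "c + d"]] by simp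
        show "u y - (c + d) * dipole e y \<le> M + \<bar>c + d\<bar> * (1 / rho)" if "norm y \<ge> rho" for y
        proof -
          have "- ((c + d) * dipole e y) \<le> \<bar>c + d\<bar> * \<bar>dipole e y\<bar>"
            by (metis abs_ge_minus_self abs_mult)
          also have "\<dots> \<le> \<bar>c + d\<bar> * (1 / rho)"
            by (intro mult_left_mono abs_dipole_le[OF e that rho]) auto
          finally show ?thesis using M[of y] by linarith
        qed
        show "u y - (c + d) * dipole e y \<le> 0" if "y \<bullet> e = 0" for y
          using flat[OF that] that by (simp add: dipole_def)
        show "u y - (c + d) * dipole e y \<le> 0" if "norm y = rho" "y \<bullet> e \<ge> 0" for y
          using near[of y] that rho by auto
      qed (use False x in auto)
      then show ?thesis by simp
    qed
  qed
  note * = this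
  have "u x - c * dipole e x \<le> d" if d: "d > 0" for d
  proof -
    have D: "dipole e x + 1 > 0" using dipole_nonneg[OF x(2)] by linarith
    have "u x \<le> (c + d / (dipole e x + 1)) * dipole e x" using *[of "d / (dipole e x + 1)"] d D by simp
    moreover have "d / (dipole e x + 1) * dipole e x \<le> d"
      using d D by (simp add: field_simps)
    ultimately show ?thesis by (simp add: distrib_right)
  qed
  then have "u x - c * dipole e x \<le> 0" by (meson dense_ge)
  then show ?thesis by simp
qed

lemma profile_ln:
  assumes "r > 0"
  shows "profile n (ln r) = r powr dual_exp n / (1 + r powr dual_exp n)"
  using assms by (simp add: profile_def powr_def)

text \<open>
  The quotient equals \<open>r powr (2 - q) (1 + r powr q)\<close>. The limit is 1 in dimension 2, where
  \<open>q = 2\<close>, and 0 in higher dimensions, where \<open>q < 2\<close> and the dipoles fail to be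
  differentiable at the origin.
\<close>

lemma square_over_profile_limit:
  assumes n: "n \<ge> 2"
  obtains L where "((\<lambda>r. r\<^sup>2 / profile n (ln r)) \<longlongrightarrow> L) (at_right 0)"
proof -
  let ?q = "dual_exp n"
  have q: "?q > 1" "?q \<le> 2" using n dual_exp_gt_1[OF n] by (simp_all add: dual_exp_def field_simps)
  have pq: "((\<lambda>r::real. r powr ?q) \<longlongrightarrow> 0) (at_right 0)"
    by (rule tendsto_zero_powrI[where b = ?q]) (use q in \<open>auto intro!: tendsto_eq_intros simp: eventually_at_filter\<close>)
  obtain L where L: "((\<lambda>r::real. r powr (2 - ?q)) \<longlongrightarrow> L) (at_right 0)"
  proof (cases "?q = 2")
    case True
    have "((\<lambda>r::real. r powr (2 - ?q)) \<longlongrightarrow> 1) (at_right 0)"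
      by (rule tendsto_eventually) (simp add: True eventually_at_filter)
    then show ?thesis by (rule that)
  next
    case False
    have "((\<lambda>r::real. r powr (2 - ?q)) \<longlongrightarrow> 0) (at_right 0)"
      by (rule tendsto_zero_powrI[where b = "2 - ?q"])
         (use q False in \<open>auto intro!: tendsto_eq_intros simp: eventually_at_filter\<close>)
    then show ?thesis by (rule that)
  qed
  have "((\<lambda>r. r powr (2 - ?q) * (1 + r powr ?q)) \<longlongrightarrow> L * (1 + 0)) (at_right 0)"
    by (intro tendsto_intros L pq)
  moreover have "\<forall>\<^sub>F r in at_right 0. r powr (2 - ?q) * (1 + r powr ?q) = r\<^sup>2 / profile n (ln r)"
  proof (rule eventually_at_rightI[of 0 1])
    fix r :: real assume "r \<in> {0<..<1}"
    then have r: "r > 0" by simp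
    then have "r powr (2 - ?q) = r\<^sup>2 / r powr ?q"
      by (simp add: powr_diff)
    then show "r powr (2 - ?q) * (1 + r powr ?q) = r\<^sup>2 / profile n (ln r)"
      using r by (simp add: profile_ln)
  qed simp
  ultimately have "((\<lambda>r. r\<^sup>2 / profile n (ln r)) \<longlongrightarrow> L * (1 + 0)) (at_right 0)"
    by (rule Lim_transform_eventually)
  then show ?thesis by (rule that)
qed

section \<open>Reflections of a bounded solution\<close>

text \<open>
  Mean value theorem on the segment from the mirror image of \<open>x\<close> to \<open>x\<close>, which stays in the
  ball of radius \<open>norm x\<close>.
\<close>

lemma reflection_increment:
  fixes e :: "real^'n::finite"
  assumes d: "\<And>x. (f has_derivative (\<lambda>v. g x \<bullet> v)) (at x)" and e: "norm e = 1"
  obtains z where "norm z \<le> norm x" "f x - f (reflect e x) = 2 * (x \<bullet> e) * (g z \<bullet> e)"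
proof -
  let ?v = "x - reflect e x"
  have v: "?v = (2 * (x \<bullet> e)) *\<^sub>R e" by (simp add: reflect_def)
  have lin: "((\<lambda>t. reflect e x + t *\<^sub>R ?v) has_derivative (\<lambda>h. h *\<^sub>R ?v)) (at t)" for t
    by (auto intro!: derivative_eq_intros)
  have D: "((\<lambda>t. f (reflect e x + t *\<^sub>R ?v)) has_real_derivative (g (reflect e x + t *\<^sub>R ?v) \<bullet> ?v)) (at t)" for t
    using has_derivative_compose[OF lin d] unfolding has_field_derivative_def
    by (rule has_derivative_eq_rhs) (auto simp: fun_eq_iff)
  obtain t where t: "0 < t" "t < 1"
    and eq: "f (reflect e x + 1 *\<^sub>R ?v) - f (reflect e x + 0 *\<^sub>R ?v) = (1 - 0) * (g (reflect e x + t *\<^sub>R ?v) \<bullet> ?v)"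
    using MVT2[OF zero_less_one D] by blast
  have "reflect e x + t *\<^sub>R ?v = (1 - t) *\<^sub>R reflect e x + t *\<^sub>R x" by (simp add: algebra_simps)
  then have "norm (reflect e x + t *\<^sub>R ?v) \<le> (1 - t) * norm (reflect e x) + t * norm x"
    using t norm_triangle_ineq[of "(1 - t) *\<^sub>R reflect e x" "t *\<^sub>R x"] by simp
  also have "\<dots> = norm x" by (simp add: norm_reflect[OF e] algebra_simps)
  finally have "norm (reflect e x + t *\<^sub>R ?v) \<le> norm x" .
  moreover have "f x - f (reflect e x) = 2 * (x \<bullet> e) * (g (reflect e x + t *\<^sub>R ?v) \<bullet> e)"
    using eq unfolding v[symmetric] by (simp add: v[symmetric]) (simp add: v)
  ultimately show ?thesis by (rule that)
qed

text \<open>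
  Near the origin the left-hand side is \<open>2 (x \<bullet> e) (g z \<bullet> e)\<close> with \<open>z\<close> close to 0, and
  \<open>x \<bullet> e\<close> is \<open>r\<^sup>2 / y\<close> times the dipole; so the quotient with the dipole tends to
  \<open>2 L (g 0 \<bullet> e)\<close>.
\<close>

lemma reflection_difference_le:
  fixes \<phi> :: "real^'n::finite \<Rightarrow> real"
  assumes n: "CARD('n) \<ge> 2" and e: "norm e = 1"
    and d: "\<And>x. (\<phi> has_derivative (\<lambda>v. g x \<bullet> v)) (at x)" and g: "isCont g 0"
    and M: "\<And>x. \<bar>\<phi> x\<bar> \<le> M"
    and l: "has_liouville \<phi> (\<lambda>x. 0) (-{0})"
    and L: "((\<lambda>r. r\<^sup>2 / profile CARD('n) (ln r)) \<longlongrightarrow> L) (at_right 0)"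
    and x: "x \<noteq> 0" "x \<bullet> e \<ge> 0"
  shows "\<phi> x - \<phi> (reflect e x) \<le> 2 * L * (g 0 \<bullet> e) * dipole e x"
proof (rule halfspace_comparison[OF n e _ _ _ _ x, where u = "\<lambda>x. \<phi> x - \<phi> (reflect e x)" and M = "2 * M"])
  show "has_liouville (\<lambda>x. \<phi> x - \<phi> (reflect e x)) (\<lambda>x. 0) (-{0})"
    using has_liouville_diff[OF l has_liouville_reflect[OF e l]] by simp
  show "\<phi> x - \<phi> (reflect e x) \<le> 2 * M" for x using M[of x] M[of "reflect e x"] by linarith
  show "\<phi> x - \<phi> (reflect e x) \<le> 0" if "x \<bullet> e = 0" for x using that by (simp add: reflect_def)
  fix d :: real assume d0: "d > 0"
  define p where "p = g 0 \<bullet> e"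
  \<comment> \<open>Small enough that errors \<open>eps\<close> in the two factors \<open>g z \<bullet> e\<close> and \<open>r\<^sup>2 / y\<close> change
    twice their product by at most \<open>d\<close>.\<close>
  define eps where "eps = min 1 (d / (2 * (\<bar>L\<bar> + 1 + \<bar>p\<bar>)))"
  have eps: "eps > 0" "eps \<le> 1" "2 * eps * (\<bar>L\<bar> + 1 + \<bar>p\<bar>) \<le> d"
  proof -
    have pos: "2 * (\<bar>L\<bar> + 1 + \<bar>p\<bar>) > 0"
      using abs_ge_zero[of L] abs_ge_zero[of p] by (simp add: add_pos_nonneg)
    show "eps > 0" "eps \<le> 1" using d0 pos by (auto simp: eps_def)
    have "eps \<le> d / (2 * (\<bar>L\<bar> + 1 + \<bar>p\<bar>))" by (simp add: eps_def)
    then have "eps * (2 * (\<bar>L\<bar> + 1 + \<bar>p\<bar>)) \<le> d" using pos by (simp add: pos_le_divide_eq)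
    then show "2 * eps * (\<bar>L\<bar> + 1 + \<bar>p\<bar>) \<le> d" by (simp add: mult_ac)
  qed
  have "isCont (\<lambda>z. g z \<bullet> e) 0" using g by (intro continuous_intros)
  then obtain r1 where r1: "r1 > 0" "\<And>z. norm z < r1 \<Longrightarrow> \<bar>g z \<bullet> e - p\<bar> < eps"
    using eps(1) unfolding continuous_at_eps_delta p_def by (auto simp: dist_norm)
  from L eps(1) have "\<forall>\<^sub>F r in at_right 0. dist (r\<^sup>2 / profile CARD('n) (ln r)) L < eps"
    by (rule tendstoD)
  then obtain r2 where r2: "r2 > 0" "\<And>r. 0 < r \<Longrightarrow> r < r2 \<Longrightarrow> \<bar>r\<^sup>2 / profile CARD('n) (ln r) - L\<bar> < eps"
    by (auto simp: eventually_at_right_field dist_real_def)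
  show "\<exists>rho>0. \<forall>x. x \<noteq> 0 \<longrightarrow> norm x \<le> rho \<longrightarrow> x \<bullet> e \<ge> 0 \<longrightarrow>
      \<phi> x - \<phi> (reflect e x) \<le> (2 * L * (g 0 \<bullet> e) + d) * dipole e x"
  proof (intro exI[of _ "min r1 r2 / 2"] conjI allI impI)
    show "min r1 r2 / 2 > 0" using r1 r2 by simp
    fix x :: "real^'n" assume x: "x \<noteq> 0" "norm x \<le> min r1 r2 / 2" "x \<bullet> e \<ge> 0"
    have r: "norm x > 0" "norm x < r1" "norm x < r2" using x r1 r2 by auto
    obtain z where z: "norm z \<le> norm x" "\<phi> x - \<phi> (reflect e x) = 2 * (x \<bullet> e) * (g z \<bullet> e)"
      using reflection_increment[OF assms(3) e] by blast
    define a where "a = (norm x)\<^sup>2 / profile CARD('n) (ln (norm x))"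
    define b where "b = g z \<bullet> e"
    have a: "\<bar>a - L\<bar> < eps" unfolding a_def by (rule r2(2)) (use r in auto)
    have b: "\<bar>b - p\<bar> < eps" unfolding b_def by (rule r1(2)) (use r z in auto)
    have "2 * (b * a) - 2 * (p * L) = 2 * ((b - p) * a + p * (a - L))" by (simp add: algebra_simps)
    also have "\<dots> \<le> 2 * (eps * (\<bar>L\<bar> + 1) + \<bar>p\<bar> * eps)"
    proof -
      have "(b - p) * a \<le> \<bar>b - p\<bar> * \<bar>a\<bar>" by (metis abs_ge_self abs_mult)
      also have "\<dots> \<le> eps * (\<bar>L\<bar> + 1)" using a b eps by (intro mult_mono) auto
      finally have 1: "(b - p) * a \<le> eps * (\<bar>L\<bar> + 1)" .
      have "p * (a - L) \<le> \<bar>p\<bar> * \<bar>a - L\<bar>" by (metis abs_ge_self abs_mult)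
      also have "\<dots> \<le> \<bar>p\<bar> * eps" using a by (intro mult_left_mono) auto
      finally show ?thesis using 1 by simp
    qed
    also have "\<dots> = 2 * eps * (\<bar>L\<bar> + 1 + \<bar>p\<bar>)" by (simp add: algebra_simps)
    also have "\<dots> \<le> d" by (rule eps(3))
    finally have ab: "2 * (b * a) \<le> 2 * L * p + d" by (simp add: mult_ac)
    have "\<phi> x - \<phi> (reflect e x) = 2 * (b * a) * dipole e x"
      using r profile_bounds(1)[of "CARD('n)" "ln (norm x)"] by (simp add: z(2) a_def b_def dipole_def)
    also have "\<dots> \<le> (2 * L * p + d) * dipole e x"
      by (rule mult_right_mono[OF ab dipole_nonneg[OF x(3)]])
    finally show "\<phi> x - \<phi> (reflect e x) \<le> (2 * L * (g 0 \<bullet> e) + d) * dipole e x" by (simp add: p_def)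
  qed
qed

text \<open>
  The one-sided bound holds for \<open>\<phi>\<close> and \<open>- \<phi>\<close> on one half space; both sides are odd under
  the reflection.
\<close>

lemma reflection_difference:
  fixes \<phi> :: "real^'n::finite \<Rightarrow> real"
  assumes n: "CARD('n) \<ge> 2" and e: "norm e = 1"
    and d: "\<And>x. (\<phi> has_derivative (\<lambda>v. g x \<bullet> v)) (at x)" and g: "isCont g 0"
    and M: "\<And>x. \<bar>\<phi> x\<bar> \<le> M"
    and l: "has_liouville \<phi> (\<lambda>x. 0) (-{0})"
    and L: "((\<lambda>r. r\<^sup>2 / profile CARD('n) (ln r)) \<longlongrightarrow> L) (at_right 0)"
    and x: "x \<noteq> 0"
  shows "\<phi> x - \<phi> (reflect e x) = 2 * L * (g 0 \<bullet> e) * dipole e x"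
proof -
  have pos: "\<phi> y - \<phi> (reflect e y) = 2 * L * (g 0 \<bullet> e) * dipole e y" if y: "y \<noteq> 0" "y \<bullet> e \<ge> 0" for y
  proof (rule antisym)
    show "\<phi> y - \<phi> (reflect e y) \<le> 2 * L * (g 0 \<bullet> e) * dipole e y"
      by (rule reflection_difference_le[OF n e d g M l L y])
    have "- \<phi> y - - \<phi> (reflect e y) \<le> 2 * L * (- g 0 \<bullet> e) * dipole e y"
    proof (rule reflection_difference_le[OF n e _ _ _ _ L y, where \<phi> = "\<lambda>x. - \<phi> x" and g = "\<lambda>x. - g x" and M = M])
      show "((\<lambda>x. - \<phi> x) has_derivative (\<lambda>v. - g x \<bullet> v)) (at x)" for x
        using has_derivative_minus[OF d[of x]] by simp
      show "isCont (\<lambda>x. - g x) 0" using g by (intro continuous_intros)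
      show "\<bar>- \<phi> x\<bar> \<le> M" for x using M by simp
      show "has_liouville (\<lambda>x. - \<phi> x) (\<lambda>x. 0) (-{0})"
        using has_liouville_scale[OF l, of "-1"] by simp
    qed
    then show "2 * L * (g 0 \<bullet> e) * dipole e y \<le> \<phi> y - \<phi> (reflect e y)" by simp
  qed
  show ?thesis
  proof (cases "x \<bullet> e \<ge> 0")
    case True
    then show ?thesis using pos x by blast
  next
    case False
    have "reflect e x \<noteq> 0" using x norm_reflect[OF e, of x] by (metis norm_eq_zero)
    moreover have "reflect e x \<bullet> e \<ge> 0" using False by (simp add: reflect_inner_axis[OF e])
    ultimately have "\<phi> (reflect e x) - \<phi> x = 2 * L * (g 0 \<bullet> e) * dipole e (reflect e x)"
      using pos[of "reflect e x"] by (simp add: reflect_reflect[OF e])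
    moreover have "dipole e (reflect e x) = - dipole e x"
      by (simp add: dipole_def norm_reflect[OF e] reflect_inner_axis[OF e])
    ultimately show ?thesis by simp
  qed
qed

section \<open>Radial solutions\<close>

lemma profile_at_bot: "n \<ge> 2 \<Longrightarrow> (profile n \<longlongrightarrow> 0) at_bot"
proof -
  assume n: "n \<ge> 2"
  have "filterlim (\<lambda>s. dual_exp n * s) at_bot at_bot"
    using dual_exp_gt_1[OF n] by (intro filterlim_tendsto_pos_mult_at_bot[OF tendsto_const]) (auto simp: filterlim_ident)
  then have "((\<lambda>s. exp (dual_exp n * s)) \<longlongrightarrow> 0) at_bot"
    by (rule filterlim_compose[OF exp_at_bot])
  then have "((\<lambda>s. exp (dual_exp n * s) / (1 + exp (dual_exp n * s))) \<longlongrightarrow> 0 / (1 + 0)) at_bot"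
    by (intro tendsto_intros) auto
  then show ?thesis by (simp add: profile_def[abs_def])
qed

lemma DERIV_0_constant:
  fixes W :: "real \<Rightarrow> real"
  assumes "\<And>s. (W has_real_derivative 0) (at s)" "(W \<longlongrightarrow> c) at_bot"
  shows "W s = c"
proof -
  have "W t = W s" for t using DERIV_isconst_all assms(1) by blast
  then have "(W \<longlongrightarrow> W s) at_bot" by (intro tendsto_eventually) simp
  then show ?thesis using tendsto_unique[OF trivial_limit_at_bot_linorder _ assms(2)] by blast
qed

text \<open>
  The function \<open>z = 1 - q y\<close> is a solution, and \<open>y ^ (n - 2)\<close> times the Wronskian
  \<open>F' z - F z'\<close> is constant. Since it tends to 0 as \<open>s\<close> tends to \<open>- \<infinity>\<close>, it vanishes, and \<open>F / z\<close> is constant on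
  both sides of the only zero \<open>s0\<close> of \<open>z\<close>. There \<open>F\<close> vanishes too, and \<open>F / z\<close> has the limit
  \<open>F' / z'\<close> from both sides, so the two constants agree.
\<close>

lemma radial_solution_eq:
  fixes F F1 F2 :: "real \<Rightarrow> real"
  assumes n: "n \<ge> 2"
    and F: "\<And>s. (F has_real_derivative F1 s) (at s)" "\<And>s. (F1 has_real_derivative F2 s) (at s)"
    and ode: "\<And>s. radial_op n 0 s (F s) (F1 s) (F2 s) = 0"
    and lim: "(F \<longlongrightarrow> c) at_bot" "(F1 \<longlongrightarrow> 0) at_bot"
  shows "F s = c * (1 - dual_exp n * profile n s)"
proof -
  define y where "y = profile n"
  define q where "q = dual_exp n"
  have yb: "0 < y s" "y s < 1" for s by (simp_all add: y_def profile_bounds)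
  have q: "q > 1" using dual_exp_gt_1[OF n] by (simp add: q_def)
  have qn: "q * (real n - 1) = real n" using dual_exp_mult[OF n] by (simp add: q_def)
  have dy: "(y has_real_derivative q * y s * (1 - y s)) (at s)" for s
    unfolding y_def q_def by (auto intro!: derivative_eq_intros)
  define z where "z s = 1 - q * y s" for s
  define z1 where "z1 s = - q\<^sup>2 * y s * (1 - y s)" for s
  define z2 where "z2 s = - (q ^ 3) * y s * (1 - y s) * (1 - 2 * y s)" for s
  have dz: "(z has_real_derivative z1 s) (at s)" for s
    unfolding z_def z1_def by (auto intro!: derivative_eq_intros dy simp: power2_eq_square)
  have dz1: "(z1 has_real_derivative z2 s) (at s)" for s
    unfolding z1_def z2_def by (auto intro!: derivative_eq_intros dy simp: power2_eq_square power3_eq_cube algebra_simps)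
  define w where "w s = F1 s * z s - F s * z1 s" for s
  have ylim: "(y \<longlongrightarrow> 0) at_bot" unfolding y_def by (rule profile_at_bot[OF n])
  have zlim: "(z \<longlongrightarrow> 1 - q * 0) at_bot" unfolding z_def by (intro tendsto_intros ylim)
  have z1lim: "(z1 \<longlongrightarrow> - q\<^sup>2 * 0 * (1 - 0)) at_bot" unfolding z1_def by (intro tendsto_intros ylim)
  have wlim: "(w \<longlongrightarrow> 0 * (1 - q * 0) - c * (- q\<^sup>2 * 0 * (1 - 0))) at_bot"
    unfolding w_def by (intro tendsto_intros lim zlim z1lim)
  have dw: "(w has_real_derivative - (real n - 2) * q * (1 - y s) * w s) (at s)" for s
  proof -
    have e1: "(real n - 1) * F2 s + real n * (real n - 2) * (1 - y s) * F1 s + (real n)\<^sup>2 * q * y s * (1 - y s) * F s = 0"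
      using ode[of s] by (simp add: radial_op_def y_def q_def)
    define m where "m = real n - 1"
    have nm: "real n = m + 1" by (simp add: m_def)
    have m0: "m \<noteq> 0" using n by (simp add: m_def)
    have qm: "q * m = m + 1" using qn by (simp add: m_def)
    have e2: "m * z2 s + (m + 1) * (m - 1) * (1 - y s) * z1 s + (m + 1)\<^sup>2 * q * y s * (1 - y s) * z s = 0"
      unfolding z_def z1_def z2_def using qm by algebra
    have e1': "m * F2 s + (m + 1) * (m - 1) * (1 - y s) * F1 s + (m + 1)\<^sup>2 * q * y s * (1 - y s) * F s = 0"
      using e1 by (simp add: nm)
    have "m * (F2 s * z s - F s * z2 s) = m * (- (m - 1) * q * (1 - y s) * (F1 s * z s - F s * z1 s))"
      using e1' e2 qm by algebra
    then have "F2 s * z s - F s * z2 s = - (m - 1) * q * (1 - y s) * w s"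
      using m0 by (simp add: w_def)
    moreover have "(w has_real_derivative (F2 s * z s + z1 s * F1 s) - (F1 s * z1 s + z2 s * F s)) (at s)"
      unfolding w_def by (intro DERIV_diff DERIV_mult F dz dz1)
    ultimately show ?thesis by (simp add: nm mult.commute)
  qed
  define W where "W s = y s ^ (n - 2) * w s" for s
  have "W s = 0" for s
  proof (rule DERIV_0_constant[where W = W])
    show "(W has_real_derivative 0) (at s)" for s
    proof -
      have "((\<lambda>s. y s ^ (n - 2)) has_real_derivative (real n - 2) * q * (1 - y s) * y s ^ (n - 2)) (at s)"
      proof (rule DERIV_cong[OF DERIV_power[OF dy]])
        have "real (n - 2) = real n - 2" using n by simp
        then show "real (n - 2) * (q * y s * (1 - y s) * y s ^ (n - 2 - Suc 0)) = (real n - 2) * q * (1 - y s) * y s ^ (n - 2)"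
          by (cases "n - 2") auto
      qed
      from DERIV_mult[OF this dw] show ?thesis unfolding W_def by (simp add: algebra_simps)
    qed
    show "(W \<longlongrightarrow> 0) at_bot"
    proof (rule Lim_null_comparison)
      show "\<forall>\<^sub>F s in at_bot. norm (W s) \<le> \<bar>w s\<bar>"
      proof (rule always_eventually, rule allI)
        fix s
        have "y s ^ (n - 2) \<le> 1" using yb[of s] by (simp add: power_le_one)
        then show "norm (W s) \<le> \<bar>w s\<bar>"
          using yb[of s] by (simp add: W_def abs_mult mult_left_le_one_le)
      qed
      show "((\<lambda>s. \<bar>w s\<bar>) \<longlongrightarrow> 0) at_bot" using tendsto_rabs[OF wlim] by simp
    qed
  qed
  note W0 = this
  have w0: "F1 s * z s = F s * z1 s" for s
  proof -
    have "y s ^ (n - 2) \<noteq> 0" using yb(1)[of s] by simp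
    then have "w s = 0" using W0[of s] unfolding W_def by (simp del: power_eq_0_iff)
    then show ?thesis by (simp add: w_def)
  qed
  have z1neg: "z1 s < 0" for s using yb[of s] q by (simp add: z1_def)
  have z_dec: "z s > z t" if "s < t" for s t
    by (rule DERIV_neg_imp_decreasing[OF that]) (use dz z1neg in blast)
  \<comment> \<open>The point where the profile takes the value \<open>1 / q\<close>.\<close>
  define s0 where "s0 = - ln (q - 1) / q"
  have z0: "z s0 = 0"
  proof -
    have "q * s0 = - ln (q - 1)" using q by (simp add: s0_def)
    then have "exp (q * s0) = 1 / (q - 1)" using q by (simp add: exp_minus inverse_eq_divide)
    then have "y s0 = (1 / (q - 1)) / (1 + 1 / (q - 1))" by (simp add: y_def profile_def q_def[symmetric])
    also have "1 + 1 / (q - 1) = q / (q - 1)" using q by (simp add: field_simps)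
    finally have "y s0 = 1 / q" using q by simp
    then show ?thesis using q by (simp add: z_def)
  qed
  have F0: "F s0 = 0" using w0[of s0] z0 z1neg[of s0] by simp
  have quot: "((\<lambda>s. F s / z s) has_real_derivative 0) (at s)" if "z s \<noteq> 0" for s
    by (rule DERIV_cong[OF DERIV_divide[OF F(1) dz that]]) (use w0[of s] in simp)
  have zneq: "z s \<noteq> 0" if "s \<noteq> s0" for s
    using z_dec[of s s0] z_dec[of s0 s] z0 that by (metis less_irrefl linorder_neqE_linordered_idom)
  obtain a where a: "\<And>s. s < s0 \<Longrightarrow> F s / z s = a"
  proof -
    have "\<exists>a. \<forall>s\<in>{..<s0}. F s / z s = a"
      by (rule has_field_derivative_zero_constant)
         (auto intro!: has_field_derivative_at_within quot zneq)
    then show ?thesis using that by auto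
  qed
  obtain b where b: "\<And>s. s > s0 \<Longrightarrow> F s / z s = b"
  proof -
    have "\<exists>b. \<forall>s\<in>{s0<..}. F s / z s = b"
      by (rule has_field_derivative_zero_constant)
         (auto intro!: has_field_derivative_at_within quot zneq)
    then show ?thesis using that by auto
  qed
  have slope: "((\<lambda>s. F s / z s) \<longlongrightarrow> F1 s0 / z1 s0) (at s0)"
  proof -
    have "((\<lambda>s. (F s - F s0) / (s - s0) / ((z s - z s0) / (s - s0))) \<longlongrightarrow> F1 s0 / z1 s0) (at s0)"
      using F(1)[of s0] dz[of s0] z1neg[of s0] unfolding has_field_derivative_iff
      by (intro tendsto_divide) auto
    moreover have "\<forall>\<^sub>F s in at s0. (F s - F s0) / (s - s0) / ((z s - z s0) / (s - s0)) = F s / z s"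
      by (auto simp: eventually_at_filter z0 F0)
    ultimately show ?thesis by (rule Lim_transform_eventually)
  qed
  have "a = F1 s0 / z1 s0"
  proof (rule tendsto_unique[of "at_left s0" "\<lambda>s. F s / z s"])
    show "((\<lambda>s. F s / z s) \<longlongrightarrow> a) (at_left s0)"
      by (rule tendsto_eventually) (auto simp: eventually_at_filter a)
    show "((\<lambda>s. F s / z s) \<longlongrightarrow> F1 s0 / z1 s0) (at_left s0)"
      using slope by (rule tendsto_within_subset) simp
  qed simp
  moreover have "b = F1 s0 / z1 s0"
  proof (rule tendsto_unique[of "at_right s0" "\<lambda>s. F s / z s"])
    show "((\<lambda>s. F s / z s) \<longlongrightarrow> b) (at_right s0)"
      by (rule tendsto_eventually) (auto simp: eventually_at_filter b)
    show "((\<lambda>s. F s / z s) \<longlongrightarrow> F1 s0 / z1 s0) (at_right s0)"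
      using slope by (rule tendsto_within_subset) simp
  qed simp
  ultimately have Fz: "F s = a * z s" for s
    using a[of s] b[of s] zneq[of s] F0 z0 by (cases s s0 rule: linorder_cases) (auto simp: field_simps)
  have "((\<lambda>s. a * z s) \<longlongrightarrow> a * (1 - q * 0)) at_bot" by (intro tendsto_intros zlim)
  then have "(F \<longlongrightarrow> a) at_bot" by (simp flip: Fz)
  then have "a = c"
    using tendsto_unique[OF trivial_limit_at_bot_linorder _ lim(1)] by blast
  then show ?thesis using Fz[of s] by (simp add: z_def q_def y_def)
qed

section \<open>Solutions as radial functions plus dipoles\<close>

lemma has_liouville_unique:
  assumes "has_liouville f k S" "has_liouville f k' S" "x \<in> S"
  shows "k x = k' x"
  using assms unfolding has_liouville_def by (metis has_jet_unique)

text \<open>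
  Two distinct points on a sphere are mirror images with respect to the hyperplane
  orthogonal to their difference.
\<close>

lemma reflection_invariant_imp_radial:
  fixes x y :: "'a::real_inner"
  assumes inv: "\<And>e x. norm e = 1 \<Longrightarrow> x \<noteq> 0 \<Longrightarrow> f (reflect e x) = f x"
    and xy: "norm x = norm y" "x \<noteq> 0"
  shows "f x = f y"
proof (cases "x = y")
  case False
  define e where "e = (1 / norm (x - y)) *\<^sub>R (x - y)"
  have d: "norm (x - y) > 0" using False by simp
  have e: "norm e = 1" using d by (simp add: e_def)
  have "2 * (x \<bullet> (x - y)) = (norm (x - y))\<^sup>2"
    using xy(1) unfolding norm_eq
    by (simp add: power2_norm_eq_inner inner_diff_left inner_diff_right inner_commute)
  then have "(2 * (x \<bullet> e)) *\<^sub>R e = x - y"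
    using d by (simp add: e_def power2_eq_square)
  then have "reflect e x = y" by (simp add: reflect_def)
  then show ?thesis using inv[OF e xy(2)] by simp
qed simp

lemma essentially_bounded_continuous:
  fixes f :: "real^'n::finite \<Rightarrow> real"
  assumes "L_infinity f" "continuous_on UNIV f"
  obtains M where "\<And>x. \<bar>f x\<bar> \<le> M"
proof -
  obtain M where M: "AE x in lebesgue. \<bar>f x\<bar> \<le> M" using assms(1) unfolding L_infinity_def by blast
  have op: "open {x. \<not> \<bar>f x\<bar> \<le> M}"
    unfolding not_le by (intro open_Collect_less continuous_intros assms(2))
  then have "{x. \<not> \<bar>f x\<bar> \<le> M} \<in> sets lebesgue" by simp
  then have "negligible {x. \<not> \<bar>f x\<bar> \<le> M}"
    using M AE_iff_null[of lebesgue "\<lambda>x. \<bar>f x\<bar> \<le> M"] by (simp add: negligible_iff_null_sets)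
  then have "{x. \<not> \<bar>f x\<bar> \<le> M} = {}" using open_not_negligible[OF op] by blast
  then show ?thesis by (intro that[of M]) auto
qed

text \<open>
  The reflection identity says that \<open>psi = \<phi> - L dipole (g 0)\<close> is invariant under
  reflections, hence radial. As dipoles are odd, the profile of \<open>psi\<close> is the mean of \<open>\<phi>\<close> at
  opposite points; this form shows that it tends to \<open>\<phi> 0\<close> and its derivative to 0 at the
  origin, from the continuity of \<open>\<phi>\<close> and \<open>g\<close> alone.
\<close>

lemma solution_eq_radial_plus_dipole:
  fixes \<phi> :: "real^'n::finite \<Rightarrow> real"
  assumes n: "CARD('n) \<ge> 2"
    and j: "has_jet \<phi> g H UNIV" and g: "isCont g 0"
    and l: "has_liouville \<phi> (\<lambda>x. 0) (-{0})"
    and L: "\<And>e x. norm e = 1 \<Longrightarrow> x \<noteq> 0 \<Longrightarrow> \<phi> x - \<phi> (reflect e x) = 2 * L * (g 0 \<bullet> e) * dipole e x"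
    and x: "x \<noteq> 0"
  shows "\<phi> x = \<phi> 0 * (1 - dual_exp CARD('n) * profile CARD('n) (ln (norm x))) + L * dipole (g 0) x"
proof -
  define psi where "psi x = \<phi> x - L * dipole (g 0) x" for x
  have psi_inv: "psi (reflect e x) = psi x" if e: "norm e = 1" and x: "x \<noteq> 0" for e x
  proof -
    have "dipole (g 0) x - dipole (g 0) (reflect e x) = 2 * (g 0 \<bullet> e) * dipole e x"
    proof -
      have "reflect e x \<bullet> g 0 = x \<bullet> g 0 - 2 * (x \<bullet> e) * (g 0 \<bullet> e)"
        by (simp add: reflect_def inner_diff_left inner_commute[of e])
      then show ?thesis
        unfolding dipole_def norm_reflect[OF e] by (simp add: right_diff_distrib)
    qed
    then have "L * dipole (g 0) x - L * dipole (g 0) (reflect e x) = 2 * L * (g 0 \<bullet> e) * dipole e x"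
      by (metis (no_types, lifting) mult.assoc mult.left_commute right_diff_distrib')
    then show ?thesis using L[OF e x] by (simp add: psi_def)
  qed
  have psi_radial: "psi x = psi y" if "norm x = norm y" "x \<noteq> 0" for x y
    using reflection_invariant_imp_radial[of psi, OF psi_inv that] .
  obtain i :: 'n where True by blast
  define a :: "real^'n" where "a = axis i 1"
  have a: "norm a = 1" by (simp add: a_def)
  define p where "p s = exp s *\<^sub>R a" for s :: real
  have p: "norm (p s) = exp s" "p s \<noteq> 0" for s using a by (auto simp: p_def)
  have dp: "(p has_derivative (\<lambda>h. h *\<^sub>R p s)) (at s)" for s
    unfolding p_def by (auto intro!: derivative_eq_intros)
  have dm: "((\<lambda>s. - p s) has_derivative (\<lambda>h. h *\<^sub>R - p s)) (at s)" for s
    using has_derivative_minus[OF dp[of s]] by simp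
  \<comment> \<open>A ray parametrised by \<open>s = ln r\<close> satisfies \<open>c' = c\<close>.\<close>
  have curve: "((\<lambda>s. \<phi> (c s)) has_real_derivative (g (c s) \<bullet> c s)) (at s)"
      "((\<lambda>s. g (c s) \<bullet> c s) has_real_derivative (H (c s) (c s) \<bullet> c s + g (c s) \<bullet> c s)) (at s)"
    if c: "\<And>s. (c has_derivative (\<lambda>h. h *\<^sub>R c s)) (at s)" for c :: "real \<Rightarrow> real^'n" and s
  proof -
    show "((\<lambda>s. \<phi> (c s)) has_real_derivative (g (c s) \<bullet> c s)) (at s)"
      using has_derivative_compose[OF c has_jetD(1)[OF j UNIV_I]]
      unfolding has_field_derivative_def by (rule has_derivative_eq_rhs) (auto simp: fun_eq_iff)
    have "H (c s) (h *\<^sub>R c s) = h *\<^sub>R H (c s) (c s)" for h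
      using has_jetD(3)[OF j UNIV_I, of "c s"] by (simp add: bounded_linear.linear linear_cmul)
    then show "((\<lambda>s. g (c s) \<bullet> c s) has_real_derivative (H (c s) (c s) \<bullet> c s + g (c s) \<bullet> c s)) (at s)"
      unfolding has_field_derivative_def
      by (intro has_derivative_eq_rhs[OF has_derivative_inner[OF has_derivative_compose[OF c has_jetD(2)[OF j UNIV_I]] c]])
         (auto simp: fun_eq_iff algebra_simps)
  qed
  define F where "F s = (\<phi> (p s) + \<phi> (- p s)) / 2" for s
  define F1 where "F1 s = (g (p s) \<bullet> p s + g (- p s) \<bullet> - p s) / 2" for s
  define F2 where "F2 s = (H (p s) (p s) \<bullet> p s + g (p s) \<bullet> p s + (H (- p s) (- p s) \<bullet> - p s + g (- p s) \<bullet> - p s)) / 2" for s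
  have F: "(F has_real_derivative F1 s) (at s)" for s
    unfolding F_def F1_def by (intro DERIV_cdivide DERIV_add curve dp dm)
  have F1: "(F1 has_real_derivative F2 s) (at s)" for s
    unfolding F1_def F2_def by (intro DERIV_cdivide DERIV_add curve dp dm)
  have psi_F: "psi x = F (ln (norm x))" if "x \<noteq> 0" for x
  proof -
    define P where "P = p (ln (norm x))"
    have P: "norm P = norm x" "P \<noteq> 0" using p that by (simp_all add: P_def)
    have P1: "psi P = psi x" using P by (rule psi_radial)
    have P2: "psi (- P) = psi x" by (rule psi_radial) (use P in simp_all)
    have "F (ln (norm x)) = (psi P + psi (- P)) / 2"
      by (simp add: psi_def F_def dipole_def P_def)
    also have "\<dots> = psi x" by (simp add: P1 P2)
    finally show ?thesis by (rule sym)
  qed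
  have "has_liouville psi (\<lambda>x. 0 - L * 0) (-{0})"
    unfolding psi_def by (intro has_liouville_diff has_liouville_scale l dipole_has_liouville[OF n])
  then have lF: "has_liouville (\<lambda>x. F (ln (norm x))) (\<lambda>x. 0) (-{0::real^'n})"
    by (rule has_liouville_cong) (use psi_F in auto)
  have ode: "radial_op CARD('n) 0 s (F s) (F1 s) (F2 s) = 0" for s
    using has_liouville_unique[OF has_liouville_radial[OF F F1] lF, of "p s"] p by simp
  have exp0: "((\<lambda>s::real. exp s) \<longlongrightarrow> 0) at_bot" by (rule exp_at_bot)
  have plim: "(p \<longlongrightarrow> 0) at_bot" unfolding p_def using tendsto_scaleR[OF exp0 tendsto_const[of a]] by simp
  have mlim: "((\<lambda>s. - p s) \<longlongrightarrow> 0) at_bot" using tendsto_minus[OF plim] by simp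
  have phi0: "isCont \<phi> 0" using has_derivative_continuous[OF has_jetD(1)[OF j UNIV_I]] .
  have "((\<lambda>s. (\<phi> (p s) + \<phi> (- p s)) / 2) \<longlongrightarrow> (\<phi> 0 + \<phi> 0) / 2) at_bot"
    by (intro tendsto_intros isCont_tendsto_compose[OF phi0] plim mlim) simp
  then have Flim: "(F \<longlongrightarrow> \<phi> 0) at_bot" by (simp add: F_def[abs_def])
  have "((\<lambda>s. (g (p s) \<bullet> p s + g (- p s) \<bullet> - p s) / 2) \<longlongrightarrow> (g 0 \<bullet> 0 + g 0 \<bullet> 0) / 2) at_bot"
    by (intro tendsto_divide tendsto_add tendsto_inner tendsto_const isCont_tendsto_compose[OF g] plim mlim) simp
  then have F1lim: "(F1 \<longlongrightarrow> 0) at_bot" by (simp add: F1_def[abs_def])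
  have "F (ln (norm x)) = \<phi> 0 * (1 - dual_exp CARD('n) * profile CARD('n) (ln (norm x)))"
    by (rule radial_solution_eq[OF n F F1 ode Flim F1lim])
  then show ?thesis using psi_F[OF x] by (simp add: psi_def)
qed

theorem theorem1:
  fixes \<phi> :: "real^'n::finite \<Rightarrow> real"
  assumes "CARD('n) \<ge> 2"
    and "L_infinity \<phi>"
    and "C2 \<phi>"
    and "\<And>x. x \<noteq> 0 \<Longrightarrow> linearized_op \<phi> x = 0"
  shows "\<exists>(c0::real) (c :: 'n \<Rightarrow> real).
           \<forall>x. \<phi> x = c0 * Z0 x + (\<Sum>i\<in>UNIV. c i * Z i x)"
proof -
  note n = assms(1)
  define g where "g = grad \<phi>"
  define D where "D x v = (\<chi> i. grad (partial_deriv i \<phi>) x \<bullet> v)" for x v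
  have j: "has_jet \<phi> g D UNIV" unfolding g_def D_def by (rule C2_has_jet[OF assms(3)])
  have j0: "has_jet \<phi> g D (-{0})" using has_jet_subset[OF j] by (simp add: open_Compl)
  have l: "has_liouville \<phi> (\<lambda>x. 0) (-{0})"
    unfolding has_liouville_def using j0 liouville_op_eq_0[OF n j0 _ assms(4)] by blast
  have g0: "isCont g 0"
    using C1_continuous_grad[of \<phi>] assms(3) by (simp add: g_def C2_def continuous_on_eq_continuous_at)
  have d: "(\<phi> has_derivative (\<lambda>v. g x \<bullet> v)) (at x)" for x
    using has_jetD(1)[OF j UNIV_I] .
  then have "continuous_on UNIV \<phi>"
    by (meson continuous_at_imp_continuous_on has_derivative_continuous)
  then obtain M where M: "\<And>x. \<bar>\<phi> x\<bar> \<le> M" using essentially_bounded_continuous[OF assms(2)] by blast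
  obtain L where L: "((\<lambda>r. r\<^sup>2 / profile CARD('n) (ln r)) \<longlongrightarrow> L) (at_right 0)"
    by (rule square_over_profile_limit[OF n])
  have rep: "\<phi> x = \<phi> 0 * (1 - dual_exp CARD('n) * profile CARD('n) (ln (norm x))) + L * dipole (g 0) x"
    if "x \<noteq> 0" for x
    using solution_eq_radial_plus_dipole[OF n j g0 l reflection_difference[OF n _ d g0 M l L] that] .
  define k where "k = real CARD('n) * dual_exp CARD('n)"
  have k: "k > 0" using n dual_exp_gt_1[OF n] by (simp add: k_def)
  have grad0: "grad liouville_U (0::real^'n) = 0" by (rule grad_liouville_U_0[OF n])
  have Zgrad: "Z i x = grad liouville_U x $ i" for i and x :: "real^'n"
    by (simp add: Z_def grad_def)
  show ?thesis
  proof (intro exI allI)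
    fix x
    show "\<phi> x = \<phi> 0 / real CARD('n) * Z0 x + (\<Sum>i\<in>UNIV. (- L * g 0 $ i / k) * Z i x)"
    proof (cases "x = 0")
      case True
      then show ?thesis using n by (simp add: Z0_def Zgrad grad0)
    next
      case False
      define y where "y = profile CARD('n) (ln (norm x))"
      have G: "grad liouville_U x = - (k * y / (norm x)\<^sup>2) *\<^sub>R x"
        using grad_liouville_U[OF n False] by (simp add: k_def y_def)
      have "Z0 x = real CARD('n) * (1 - dual_exp CARD('n) * y)"
        using False by (simp add: Z0_def G power2_norm_eq_inner k_def algebra_simps)
      moreover have "(\<Sum>i\<in>UNIV. (- L * g 0 $ i / k) * Z i x) = L * dipole (g 0) x"
      proof -
        have "(\<Sum>i\<in>UNIV. (- L * g 0 $ i / k) * Z i x) = (\<Sum>i\<in>UNIV. L * (y / (norm x)\<^sup>2) * (x $ i * g 0 $ i))"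
          using k by (intro sum.cong refl) (simp add: Zgrad G)
        also have "\<dots> = L * dipole (g 0) x"
          by (simp add: dipole_def y_def inner_vec_def sum_distrib_left mult.assoc)
        finally show ?thesis .
      qed
      ultimately show ?thesis using rep[OF False] n by (simp add: y_def)
    qed
  qed
qed

end
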